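(* Let $a\ge b\ge c>0$, and let $V(a,b,c)$ be the value of the two-ball, three-box multi-look search-cost game with box costs $a,b,c$. Then $$V(a,b,c)=\max\{V_1,V_2,V_3\}.$$ Moreover, for each $i\in\{1,2,3\}$, whenever $V_i=\max\{V_1,V_2,V_3\}$, the distribution $h_i$ is an optimal Hider strategy. If several of the candidate values $V_1,V_2,V_3$ tie for the maximum, then every convex combination of the corresponding Hider distributions $h_i$ is also an optimal Hider strategy.
   Context: The game. There are three boxes $A,B,C$ with search costs $a,b,c$ respectively. The Hider places two identical balls in the boxes; the pure Hider strategies (placements) are $\mathcal H=\{002,011,020,101,110,200\}$, where the placement $x=x_1x_2x_3$ has $x_1,x_2,x_3$ balls in $A,B,C$ respectively. The Searcher opens boxes one at a time. Each opening of a box costs that box's search cost. If the box currently contains at least one ball, exactly one ball is recovered (removed) from it and the Searcher observes only "success"; otherwise the Searcher observes "failure", so she learns that the box is empty. She may choose each next box depending on the full history of openings and outcomes. A deterministic Searcher policy $s$ is such an adaptive rule; $C_s(x)$ is the total cost paid until both balls are found when the placement is $x$ ($+\infty$ if they are never both found). Mixed strategies are probability distributions over placements (Hider) and over deterministic policies (Searcher). The game is zero-sum: the Searcher minimizes and the Hider maximizes expected total cost. $V(a,b,c)$ is its value; a Hider strategy $h$ is optimal if every Searcher strategy has expected cost at least $V(a,b,c)$ against it. Notation. Put $T_1=a+b+c$, $T_2=a^2+b^2+c^2+ab+ac+bc$, $T_3=a^3+b^3+c^3+a^2b+a^2c+ab^2+b^2c+ac^2+bc^2+abc$. The candidate values are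 $$V_1=a+\frac{T_2}{T_1},\qquad V_2=\frac{2T_3-c^2(a+b+2c)}{T_2-c^2},\qquad V_3=\frac{2T_3}{T_2}.$$ The Hider distributions, as probability vectors on the placements in the order $(002,011,020,101,110,200)$, are $$h_1=\frac1{T_1}(0,0,0,c,b,a),\quad h_2=\frac1{T_2-c^2}(0,bc,b^2,ac,ab,a^2),\quad h_3=\frac1{T_2}(c^2,bc,b^2,ac,ab,a^2).$$ *)

theory Defs
  imports "HOL-Probability.Probability"
begin

datatype box = BoxA | BoxB | BoxC

lemma UNIV_box: "UNIV = {BoxA, BoxB, BoxC}"
  by (auto intro: box.exhaust)

instance box :: finite
  by standard (simp add: UNIV_box)

instance box :: countable
  by countable_datatype

fun box_cost :: "real \<Rightarrow> real \<Rightarrow> real \<Rightarrow> box \<Rightarrow> real" where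
  "box_cost a b c BoxA = a"
| "box_cost a b c BoxB = b"
| "box_cost a b c BoxC = c"

text \<open>A placement gives the number of balls in each box; the same type records the balls
  that are still hidden during a search.\<close>

type_synonym placement = "box \<Rightarrow> nat"

fun place :: "nat \<Rightarrow> nat \<Rightarrow> nat \<Rightarrow> placement" where
  "place i j k BoxA = i"
| "place i j k BoxB = j"
| "place i j k BoxC = k"

definition placements :: "placement set" where
  "placements = {place 0 0 2, place 0 1 1, place 0 2 0, place 1 0 1, place 1 1 0, place 2 0 0}"

text \<open>A history lists the openings so far, oldest first, each with its outcome
  (\<^const>\<open>True\<close> for success). A deterministic policy chooses the next box from the
  history; its values on histories that never occur are irrelevant.\<close>

type_synonym history = "(box \<times> bool) list"
type_synonym policy = "history \<Rightarrow> box"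

text \<open>History and remaining balls after \<open>n\<close> openings. The truncated subtraction leaves an
  empty box empty.\<close>

fun play :: "policy \<Rightarrow> placement \<Rightarrow> nat \<Rightarrow> history \<times> placement" where
  "play s x 0 = ([], x)"
| "play s x (Suc n) =
    (let (w, r) = play s x n; k = s w in (w @ [(k, 0 < r k)], r(k := r k - 1)))"

definition all_found :: "policy \<Rightarrow> placement \<Rightarrow> nat \<Rightarrow> bool" where
  "all_found s x n \<longleftrightarrow> (\<forall>k. snd (play s x n) k = 0)"

definition search_cost :: "real \<Rightarrow> real \<Rightarrow> real \<Rightarrow> policy \<Rightarrow> placement \<Rightarrow> ennreal" where
  "search_cost a b c s x =
    (if \<exists>n. all_found s x n
     then ennreal (\<Sum>(k, _) \<leftarrow> fst (play s x (LEAST n. all_found s x n)). box_cost a b c k)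
     else \<infinity>)"

definition hider_mixed :: "(placement \<Rightarrow> real) set" where
  "hider_mixed = {h. (\<forall>x. 0 \<le> h x) \<and> (\<forall>x. x \<notin> placements \<longrightarrow> h x = 0) \<and> (\<Sum>x\<in>placements. h x) = 1}"

text \<open>There are uncountably many deterministic policies, so mixed Searcher strategies are
  probability measures on the product \<open>\<sigma>\<close>-algebra, not merely discrete distributions.\<close>

definition policy_space :: "policy measure" where
  "policy_space = (\<Pi>\<^sub>M w\<in>UNIV. count_space UNIV)"

definition searcher_mixed :: "policy measure set" where
  "searcher_mixed = {S. prob_space S \<and> sets S = sets policy_space}"

definition expected_cost ::
    "real \<Rightarrow> real \<Rightarrow> real \<Rightarrow> policy measure \<Rightarrow> (placement \<Rightarrow> real) \<Rightarrow> ennreal" where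
  "expected_cost a b c S h =
    (\<Sum>x\<in>placements. ennreal (h x) * (\<integral>\<^sup>+ s. search_cost a b c s x \<partial>S))"

definition lower_value :: "real \<Rightarrow> real \<Rightarrow> real \<Rightarrow> ennreal" where
  "lower_value a b c = (SUP h\<in>hider_mixed. INF S\<in>searcher_mixed. expected_cost a b c S h)"

definition upper_value :: "real \<Rightarrow> real \<Rightarrow> real \<Rightarrow> ennreal" where
  "upper_value a b c = (INF S\<in>searcher_mixed. SUP h\<in>hider_mixed. expected_cost a b c S h)"

definition is_game_value :: "real \<Rightarrow> real \<Rightarrow> real \<Rightarrow> ennreal \<Rightarrow> bool" where
  "is_game_value a b c v \<longleftrightarrow> lower_value a b c = v \<and> upper_value a b c = v"

definition game_value :: "real \<Rightarrow> real \<Rightarrow> real \<Rightarrow> ennreal" where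
  "game_value a b c = (THE v. is_game_value a b c v)"

lemma game_value_eqI: "is_game_value a b c v \<Longrightarrow> game_value a b c = v"
  unfolding game_value_def by (rule the_equality) (auto simp: is_game_value_def)

definition optimal_hider :: "real \<Rightarrow> real \<Rightarrow> real \<Rightarrow> (placement \<Rightarrow> real) \<Rightarrow> bool" where
  "optimal_hider a b c h \<longleftrightarrow>
    h \<in> hider_mixed \<and> (\<forall>S\<in>searcher_mixed. game_value a b c \<le> expected_cost a b c S h)"

definition T1 :: "real \<Rightarrow> real \<Rightarrow> real \<Rightarrow> real" where
  "T1 a b c = a + b + c"

definition T2 :: "real \<Rightarrow> real \<Rightarrow> real \<Rightarrow> real" where
  "T2 a b c = a^2 + b^2 + c^2 + a*b + a*c + b*c"

definition T3 :: "real \<Rightarrow> real \<Rightarrow> real \<Rightarrow> real" where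
  "T3 a b c = a^3 + b^3 + c^3 + a^2*b + a^2*c + a*b^2 + b^2*c + a*c^2 + b*c^2 + a*b*c"

definition V1 :: "real \<Rightarrow> real \<Rightarrow> real \<Rightarrow> real" where
  "V1 a b c = a + T2 a b c / T1 a b c"

definition V2 :: "real \<Rightarrow> real \<Rightarrow> real \<Rightarrow> real" where
  "V2 a b c = (2 * T3 a b c - c^2 * (a + b + 2*c)) / (T2 a b c - c^2)"

definition V3 :: "real \<Rightarrow> real \<Rightarrow> real \<Rightarrow> real" where
  "V3 a b c = 2 * T3 a b c / T2 a b c"

text \<open>The vector with the given entries on the placements 002, 011, 020, 101, 110, 200.\<close>

definition hider_vec :: "real \<Rightarrow> real \<Rightarrow> real \<Rightarrow> real \<Rightarrow> real \<Rightarrow> real \<Rightarrow> placement \<Rightarrow> real" where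
  "hider_vec p002 p011 p020 p101 p110 p200 x =
    (if x = place 0 0 2 then p002
     else if x = place 0 1 1 then p011
     else if x = place 0 2 0 then p020
     else if x = place 1 0 1 then p101
     else if x = place 1 1 0 then p110
     else if x = place 2 0 0 then p200
     else 0)"

definition h1 :: "real \<Rightarrow> real \<Rightarrow> real \<Rightarrow> placement \<Rightarrow> real" where
  "h1 a b c x = 1 / T1 a b c * hider_vec 0 0 0 c b a x"

definition h2 :: "real \<Rightarrow> real \<Rightarrow> real \<Rightarrow> placement \<Rightarrow> real" where
  "h2 a b c x = 1 / (T2 a b c - c^2) * hider_vec 0 (b*c) (b^2) (a*c) (a*b) (a^2) x"

definition h3 :: "real \<Rightarrow> real \<Rightarrow> real \<Rightarrow> placement \<Rightarrow> real" where
  "h3 a b c x = 1 / T2 a b c * hider_vec (c^2) (b*c) (b^2) (a*c) (a*b) (a^2) x"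

text \<open>Costs are measurable in the policy, so the integral in \<open>expected_cost\<close> is the genuine
  expectation.\<close>

lemma measurable_play:
  "(\<lambda>s. play s x n) \<in> policy_space \<rightarrow>\<^sub>M count_space UNIV"
proof (induction n)
  case (Suc n)
  have "(\<lambda>s. (let (w, r) = p; k = s w in (w @ [(k, 0 < r k)], r(k := r k - 1))))
      \<in> policy_space \<rightarrow>\<^sub>M count_space UNIV" for p :: "history \<times> placement"
  proof (cases p)
    case (Pair w r)
    have "(\<lambda>s. s w) \<in> policy_space \<rightarrow>\<^sub>M count_space UNIV"
      unfolding policy_space_def by (rule measurable_component_singleton) simp
    from measurable_compose[OF this, of "\<lambda>k. (w @ [(k, 0 < r k)], r(k := r k - 1))"]
    show ?thesis
      by (simp add: Pair Let_def)
  qed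
  from measurable_compose_countable[OF this Suc.IH] show ?case
    unfolding play.simps .
qed simp

lemma measurable_search_cost:
  "(\<lambda>s. search_cost a b c s x) \<in> borel_measurable policy_space"
proof -
  have found: "Measurable.pred policy_space (\<lambda>s. all_found s x n)" for n
    unfolding all_found_def
    by (rule measurable_compose[OF measurable_play]) simp
  have hist: "(\<lambda>s. fst (play s x n)) \<in> policy_space \<rightarrow>\<^sub>M count_space UNIV" for n
    by (rule measurable_compose[OF measurable_play]) simp
  have least: "(\<lambda>s. LEAST n. all_found s x n) \<in> policy_space \<rightarrow>\<^sub>M count_space UNIV"
    by (rule measurable_Least) (rule found)
  have "(\<lambda>s. fst (play s x (LEAST n. all_found s x n))) \<in> policy_space \<rightarrow>\<^sub>M count_space UNIV"
    by (rule measurable_compose_countable[OF hist least])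
  then have "(\<lambda>s. ennreal (\<Sum>(k, _) \<leftarrow> fst (play s x (LEAST n. all_found s x n)). box_cost a b c k))
      \<in> borel_measurable policy_space"
    by (rule measurable_compose) (rule borel_measurable_count_space)
  moreover have "Measurable.pred policy_space (\<lambda>s. \<exists>n. all_found s x n)"
    by (rule pred_intros_countable(2)) (rule found)
  ultimately show ?thesis
    unfolding search_cost_def by (intro measurable_If measurable_const) (simp_all add: pred_def)
qed

end

theory Submission
  imports Defs
begin

text \<open>
  \<^emph>\<open>Why the Hider gets at least each of the three values.\<close>
  Weight every placement of \<open>m\<close> balls in a set \<open>S\<close> of boxes by the product of the costs of the
  occupied boxes, so that the total weight is the complete homogeneous polynomial \<open>H m S\<close> of the
  costs. Opening a box \<open>k\<close> of \<open>S\<close> charges its cost \<open>g k\<close> to the whole weight; after a success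
  the remaining weights are again of this form, for \<open>m - 1\<close> balls in \<open>S\<close>, multiplied by \<open>g k\<close>, and
  after a failure they are of this form for \<open>m\<close> balls in \<open>S - {k}\<close>. Since
  \<open>H (m + 1) S = g k * H m S + H (m + 1) (S - {k})\<close>, the potential \<open>m * H (m + 1) S\<close> satisfies the
  resulting recursion for every choice of \<open>k\<close>: all policies that open no box known to be empty
  have the same weighted cost, and other policies only pay more. For two balls in three boxes this
  is the bound \<open>V3\<close> for \<open>h3\<close>. The distribution \<open>h2\<close> (the same weights without \<open>002\<close>) and the
  distribution \<open>h1\<close> (one ball surely in \<open>A\<close>, the other in a box with probability proportional to
  its cost) have potentials of the same kind; see \<open>monomial_search_ge\<close>, \<open>excluded_search_ge\<close>
  and \<open>anchored_search_ge\<close>.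

  \<^emph>\<open>Why the Searcher can hold the cost down to the maximum.\<close>
  Write \<open>T\<close> for \<open>a + b + c\<close>. The three values are linked by weighted means with positive weights:
  \<open>V2\<close> is a mean of \<open>V1\<close> and \<open>T + b\<^sup>2 / (b + c)\<close>; \<open>V3\<close> is a mean of \<open>V1\<close> and
  \<open>T + (b ^ 3 + c ^ 3) / (b\<^sup>2 + b * c + c\<^sup>2)\<close>; and \<open>V3\<close> is a mean of \<open>V2\<close> and \<open>T + c\<close>. Hence the
  question which value is largest amounts to comparisons with these three thresholds.
  The Searcher randomizes over eleven policies, of which nine start with \<open>A\<close> and two with \<open>B\<close>.
  Their probabilities are chosen so that the costs against \<open>101\<close>, \<open>110\<close> and \<open>200\<close> are
  exactly the claimed value (\<open>upper_value_le_parametric\<close>); the costs against \<open>011\<close>, \<open>020\<close>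
  and \<open>002\<close> do not exceed it, and the probabilities are nonnegative, because of the order of
  the box costs and the threshold inequalities that hold in the case at hand (\<open>upper_value_le_V1\<close>,
  \<open>upper_value_le_V2\<close>, \<open>upper_value_le_V3\<close>).

  The two bounds together give the value and the optimality of each \<open>h\<close> that attains it. The
  expected cost is linear in the Hider distribution, which gives the convex combinations.
\<close>

section \<open>Search cost as a recursion on the first opening\<close>

text \<open>What remains of a policy after its first opening is itself a policy. This makes it possible to
  argue by recursion on the policy, without carrying a history along.\<close>

definition continue :: "policy \<Rightarrow> bool \<Rightarrow> policy" where
  "continue s ok = (\<lambda>w. s ((s [], ok) # w))"

definition take_one :: "box \<Rightarrow> placement \<Rightarrow> placement" where
  "take_one k x = x(k := x k - 1)"

lemma play_Suc:
  "play s x (Suc n) =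
    (let (w, r) = play (continue s (0 < x (s []))) (take_one (s []) x) n
     in ((s [], 0 < x (s [])) # w, r))"
proof (induction n)
  case 0
  show ?case by (auto simp: take_one_def Let_def)
next
  case (Suc n)
  show ?case
    by (subst play.simps(2), subst Suc.IH)
       (simp add: continue_def Let_def split: prod.splits)
qed

lemma all_found_0: "all_found s x 0 \<longleftrightarrow> (\<forall>k. x k = 0)"
  by (simp add: all_found_def)

lemma all_found_Suc:
  "all_found s x (Suc n) \<longleftrightarrow>
    all_found (continue s (0 < x (s []))) (take_one (s []) x) n"
  unfolding all_found_def play_Suc by (simp add: Let_def split: prod.splits)

lemma search_cost_done: "(\<forall>k. x k = 0) \<Longrightarrow> search_cost a b c s x = 0"
  using all_found_0[of s x] unfolding search_cost_def
  by (subst Least_eq_0) auto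

lemma search_cost_step:
  assumes "a \<ge> 0" "b \<ge> 0" "c \<ge> 0" and hidden: "\<exists>k. x k \<noteq> 0"
  shows "search_cost a b c s x =
    ennreal (box_cost a b c (s [])) +
    search_cost a b c (continue s (0 < x (s []))) (take_one (s []) x)"
proof -
  let ?t = "continue s (0 < x (s []))" and ?y = "take_one (s []) x"
  have pos: "box_cost a b c k \<ge> 0" for k
    using assms by (cases k) auto
  have not0: "\<not> all_found s x 0"
    using hidden by (simp add: all_found_0)
  show ?thesis
  proof (cases "\<exists>n. all_found ?t ?y n")
    case True
    then obtain n where n: "all_found s x (Suc n)"
      by (auto simp: all_found_Suc)
    then have "(LEAST n. all_found s x n) = Suc (LEAST n. all_found ?t ?y n)"
      using not0 by (subst Least_Suc[of _ "Suc n"]) (simp_all add: all_found_Suc)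
    moreover have "0 \<le> (\<Sum>(k, _) \<leftarrow> w. box_cost a b c k)" for w :: history
      using pos by (intro sum_list_nonneg) auto
    ultimately show ?thesis
      using n True pos unfolding search_cost_def
      by (auto simp: play_Suc Let_def simp del: play.simps(2) split: prod.splits)
  next
    case False
    have "\<not> all_found s x n" for n
      using False not0 by (cases n) (auto simp: all_found_Suc)
    with False show ?thesis
      by (auto simp: search_cost_def)
  qed
qed

text \<open>A real-valued cost for inductions on the number of openings: it agrees with
  \<^const>\<open>search_cost\<close> as soon as the given number of openings suffices.\<close>

fun cost_upto :: "(box \<Rightarrow> real) \<Rightarrow> nat \<Rightarrow> policy \<Rightarrow> placement \<Rightarrow> real" where
  "cost_upto g 0 s x = 0"
| "cost_upto g (Suc n) s x =
    (if \<forall>k. x k = 0 then 0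
     else g (s []) + cost_upto g n (continue s (0 < x (s []))) (take_one (s []) x))"

lemma search_cost_eq_cost_upto:
  assumes "a \<ge> 0" "b \<ge> 0" "c \<ge> 0"
  shows "all_found s x n \<Longrightarrow>
    search_cost a b c s x = ennreal (cost_upto (box_cost a b c) n s x) \<and>
    0 \<le> cost_upto (box_cost a b c) n s x"
proof (induction n arbitrary: s x)
  case 0
  then show ?case by (simp add: all_found_0 search_cost_done)
next
  case (Suc n)
  have "box_cost a b c (s []) \<ge> 0"
    using assms by (cases "s []") auto
  then show ?case
    using Suc.IH[of "continue s (0 < x (s []))" "take_one (s []) x"] Suc.prems assms
    by (simp add: search_cost_done search_cost_step all_found_Suc)
qed

lemma cost_upto_done: "(\<forall>k. x k = 0) \<Longrightarrow> cost_upto g n s x = 0"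
  by (cases n) auto

section \<open>Placements and complete homogeneous polynomials\<close>

definition balls_in :: "nat \<Rightarrow> box set \<Rightarrow> placement set" where
  "balls_in m S = {x. (\<forall>k. k \<notin> S \<longrightarrow> x k = 0) \<and> (\<Sum>k\<in>UNIV. x k) = m}"

definition monomial :: "(box \<Rightarrow> real) \<Rightarrow> placement \<Rightarrow> real" where
  "monomial g x = (\<Prod>k\<in>UNIV. g k ^ x k)"

text \<open>The complete homogeneous symmetric polynomial of degree \<open>m\<close> in the values of \<open>g\<close> on \<open>S\<close>.\<close>

definition hom_sym :: "(box \<Rightarrow> real) \<Rightarrow> nat \<Rightarrow> box set \<Rightarrow> real" where
  "hom_sym g m S = (\<Sum>x\<in>balls_in m S. monomial g x)"

definition add_one :: "box \<Rightarrow> placement \<Rightarrow> placement" where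
  "add_one k x = x(k := Suc (x k))"

lemma take_add_one [simp]: "take_one k (add_one k x) = x"
  by (simp add: take_one_def add_one_def)

lemma take_one_empty: "x k = 0 \<Longrightarrow> take_one k x = x"
  by (auto simp: take_one_def)

lemma finite_balls_in [simp]: "finite (balls_in m S)"
proof (rule finite_subset)
  show "balls_in m S \<subseteq> PiE UNIV (\<lambda>_. {..m})"
  proof
    fix x assume "x \<in> balls_in m S"
    then have "x k \<le> m" for k
      using member_le_sum[of k UNIV x] by (auto simp: balls_in_def)
    then show "x \<in> PiE UNIV (\<lambda>_. {..m})" by auto
  qed
qed (auto intro: finite_PiE)

lemma balls_in_0: "balls_in 0 S = {\<lambda>_. 0}"
  by (auto simp: balls_in_def)

lemma balls_in_empty: "balls_in (Suc m) {} = {}"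
  by (auto simp: balls_in_def)

lemma add_one_pos [simp]: "0 < add_one k x k"
  by (simp add: add_one_def)

lemma add_one_commute: "add_one j (add_one k x) = add_one k (add_one j x)"
  by (auto simp: add_one_def)

lemma sum_add_one: "(\<Sum>k\<in>UNIV. add_one j x k) = Suc (\<Sum>k\<in>UNIV. x k)"
proof -
  have "(\<Sum>k\<in>UNIV. add_one j x k) = (\<Sum>k\<in>UNIV. x k + of_bool (k = j))"
    by (intro sum.cong) (auto simp: add_one_def)
  then show ?thesis by (simp add: sum.distrib)
qed

lemma monomial_add_one [simp]: "monomial g (add_one j x) = g j * monomial g x"
proof -
  have "monomial g (add_one j x) = (\<Prod>k\<in>UNIV. g k ^ x k * (if k = j then g j else 1))"
    unfolding monomial_def by (intro prod.cong) (auto simp: add_one_def)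
  then show ?thesis by (simp add: prod.distrib monomial_def)
qed

text \<open>Either box \<open>k\<close> holds a ball, and removing it leaves an arbitrary placement of one ball fewer, or
  box \<open>k\<close> is empty. These are also the two outcomes of opening \<open>k\<close>, which is why the recursion of
  the homogeneous polynomials matches the recursion of the search.\<close>

lemma balls_in_split:
  assumes "k \<in> S"
  shows "balls_in (Suc m) S = add_one k ` balls_in m S \<union> balls_in (Suc m) (S - {k})"
proof (intro equalityI subsetI)
  fix x assume x: "x \<in> balls_in (Suc m) S"
  show "x \<in> add_one k ` balls_in m S \<union> balls_in (Suc m) (S - {k})"
  proof (cases "x k = 0")
    case True
    then show ?thesis using x by (auto simp: balls_in_def)
  next
    case False
    then have "x = add_one k (take_one k x)"
      by (auto simp: add_one_def take_one_def)
    moreover from this have "take_one k x \<in> balls_in m S"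
      using x sum_add_one[of k "take_one k x"]
      by (auto simp: balls_in_def take_one_def split: if_splits)
    ultimately show ?thesis by blast
  qed
next
  fix x assume "x \<in> add_one k ` balls_in m S \<union> balls_in (Suc m) (S - {k})"
  then show "x \<in> balls_in (Suc m) S"
    using assms sum_add_one by (auto simp: balls_in_def add_one_def split: if_splits)
qed

lemma sum_balls_in_split:
  fixes f :: "placement \<Rightarrow> real"
  assumes "k \<in> S"
  shows "(\<Sum>x\<in>balls_in (Suc m) S. f x) =
    (\<Sum>y\<in>balls_in m S. f (add_one k y)) + (\<Sum>x\<in>balls_in (Suc m) (S - {k}). f x)"
proof -
  have inj: "inj_on (add_one k) (balls_in m S)"
    by (rule inj_on_inverseI[of _ "take_one k"]) simp
  have "add_one k ` balls_in m S \<inter> balls_in (Suc m) (S - {k}) = {}"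
    by (auto simp: balls_in_def add_one_def)
  then show ?thesis
    unfolding balls_in_split[OF assms]
    by (subst sum.union_disjoint) (simp_all add: sum.reindex[OF inj])
qed

lemma hom_sym_split:
  assumes "k \<in> S"
  shows "hom_sym g (Suc m) S = g k * hom_sym g m S + hom_sym g (Suc m) (S - {k})"
  using sum_balls_in_split[OF assms, of "monomial g" m]
  by (simp add: hom_sym_def sum_distrib_left)

lemma hom_sym_0 [simp]: "hom_sym g 0 S = 1"
  by (simp add: hom_sym_def balls_in_0 monomial_def)

lemma hom_sym_empty [simp]: "hom_sym g (Suc m) {} = 0"
  by (simp add: hom_sym_def balls_in_empty)

lemma hom_sym_nonneg: "(\<And>k. g k \<ge> 0) \<Longrightarrow> hom_sym g m S \<ge> 0"
  unfolding hom_sym_def monomial_def by (intro sum_nonneg prod_nonneg zero_le_power) auto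

abbreviation no_balls :: placement where
  "no_balls \<equiv> \<lambda>_. 0"

lemma monomial_no_balls [simp]: "monomial g no_balls = 1"
  by (simp add: monomial_def)

lemma sum_balls_in_0 [simp]: "(\<Sum>x\<in>balls_in 0 S. f x) = f no_balls" for f :: "placement \<Rightarrow> real"
  by (simp add: balls_in_0)

section \<open>Search costs that no policy can beat\<close>

lemma balls_in_nonzero: "x \<in> balls_in (Suc m) S \<Longrightarrow> \<exists>k. x k \<noteq> 0"
  by (rule ccontr) (simp add: balls_in_def)

lemma add_one_in_balls_in:
  "\<lbrakk>y \<in> balls_in m S; k \<in> S\<rbrakk> \<Longrightarrow> add_one k y \<in> balls_in (Suc m) S"
  using sum_add_one[of k y] by (auto simp: balls_in_def add_one_def)

lemma balls_in_mono: "T \<subseteq> S \<Longrightarrow> balls_in m T \<subseteq> balls_in m S"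
  by (auto simp: balls_in_def)

lemma all_found_hit:
  "s [] = k \<Longrightarrow> all_found s (add_one k x) (Suc n) \<longleftrightarrow> all_found (continue s True) x n"
  by (simp add: all_found_Suc)

lemma all_found_miss:
  "\<lbrakk>s [] = k; x k = 0\<rbrakk> \<Longrightarrow> all_found s x (Suc n) \<longleftrightarrow> all_found (continue s False) x n"
  by (simp add: all_found_Suc take_one_empty)

text \<open>The Bellman step on a family of placements in which the first opening has the same outcome. The
  indexing function \<open>f\<close> allows the family to be given by placements with a fixed extra ball.\<close>

lemma sum_cost_hit:
  assumes "s [] = k"
  shows "(\<Sum>y\<in>Y. w y * cost_upto g (Suc n) s (add_one k (f y))) =
    g k * (\<Sum>y\<in>Y. w y) + (\<Sum>y\<in>Y. w y * cost_upto g n (continue s True) (f y))"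
proof -
  have "cost_upto g (Suc n) s (add_one k x) = g k + cost_upto g n (continue s True) x" for x
    using assms add_one_pos[of k x] by (auto simp del: add_one_pos)
  then show ?thesis
    by (simp add: distrib_left sum.distrib sum_distrib_left mult.commute del: cost_upto.simps)
qed

lemma sum_monomial_hit:
  assumes "s [] = k"
  shows "(\<Sum>y\<in>balls_in m S. monomial g (add_one k y) * cost_upto g (Suc n) s (add_one k y)) =
    g k * (g k * hom_sym g m S +
      (\<Sum>y\<in>balls_in m S. monomial g y * cost_upto g n (continue s True) y))"
proof -
  have "(\<Sum>y\<in>balls_in m S. monomial g (add_one k y) * cost_upto g (Suc n) s (add_one k y)) =
      g k * (\<Sum>y\<in>balls_in m S. monomial g y * cost_upto g (Suc n) s (add_one k y))"
    by (simp add: sum_distrib_left mult.assoc del: cost_upto.simps)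
  then show ?thesis
    unfolding sum_cost_hit[where s = s, OF assms] hom_sym_def .
qed

lemma sum_cost_miss:
  assumes "s [] = k" and "\<And>y. y \<in> Y \<Longrightarrow> f y k = 0" and "\<And>y. y \<in> Y \<Longrightarrow> \<exists>j. f y j \<noteq> 0"
  shows "(\<Sum>y\<in>Y. w y * cost_upto g (Suc n) s (f y)) =
    g k * (\<Sum>y\<in>Y. w y) + (\<Sum>y\<in>Y. w y * cost_upto g n (continue s False) (f y))"
proof -
  have "w y * cost_upto g (Suc n) s (f y) = g k * w y + w y * cost_upto g n (continue s False) (f y)"
    if "y \<in> Y" for y
    using assms(1) assms(2,3)[OF that] by (auto simp: take_one_empty algebra_simps)
  then show ?thesis
    by (simp add: sum.distrib sum_distrib_left del: cost_upto.simps)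
qed

text \<open>With monomial weights every useful opening is equally good: the potential
  \<open>m * hom_sym g (Suc m) S\<close> drops by exactly the weighted cost that is paid. An opening outside
  \<open>S\<close> leaves the potential unchanged and only adds cost. The horizon \<open>n\<close> makes the induction
  possible; policies that need not terminate are dealt with later.\<close>

lemma monomial_search_ge:
  assumes pos: "\<And>k. g k \<ge> 0"
  shows "(\<And>x. x \<in> balls_in m S \<Longrightarrow> all_found s x n) \<Longrightarrow>
    real m * hom_sym g (Suc m) S \<le> (\<Sum>x\<in>balls_in m S. monomial g x * cost_upto g n s x)"
proof (induction n arbitrary: m S s)
  case 0
  show ?case
  proof (cases m)
    case 0
    then show ?thesis by (simp add: balls_in_0)
  next
    case (Suc m')
    have "S = {}"
    proof (rule equals0I)
      fix k assume "k \<in> S"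
      then have x: "(\<lambda>j. if j = k then m else 0) \<in> balls_in m S"
        by (auto simp: balls_in_def)
      from "0.prems"[OF x] Suc show False
        unfolding all_found_0 by (auto dest: spec[of _ k])
    qed
    then show ?thesis by simp
  qed
next
  case (Suc n)
  show ?case
  proof (cases m)
    case 0
    then show ?thesis by (simp add: balls_in_0)
  next
    case m: (Suc m')
    define k where "k = s []"
    note sk = k_def[symmetric]
    have miss: "real m * hom_sym g (Suc m) T + g k * hom_sym g m T
        \<le> (\<Sum>x\<in>balls_in m T. monomial g x * cost_upto g (Suc n) s x)"
      if T: "T \<subseteq> S" "k \<notin> T" for T
    proof -
      have k0: "x k = 0" if "x \<in> balls_in m T" for x
        using that T(2) by (auto simp: balls_in_def)
      have later: "all_found s x (Suc n) \<longleftrightarrow> all_found (continue s False) x n"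
        if "x \<in> balls_in m T" for x
        using sk k0[OF that] by (rule all_found_miss)
      have "real m * hom_sym g (Suc m) T
          \<le> (\<Sum>x\<in>balls_in m T. monomial g x * cost_upto g n (continue s False) x)"
        using Suc.prems balls_in_mono[OF T(1)] later
        by (intro Suc.IH) blast
      then show ?thesis
        using sum_cost_miss[where s = s, OF sk, of "balls_in m T" "\<lambda>x. x"] k0 balls_in_nonzero m
        by (simp add: hom_sym_def del: cost_upto.simps)
    qed
    show ?thesis
    proof (cases "k \<in> S")
      case False
      then show ?thesis
        using miss[of S] mult_nonneg_nonneg[OF pos[of k] hom_sym_nonneg[of g m S, OF pos]]
        by simp
    next
      case True
      have "real m' * hom_sym g (Suc m') S
          \<le> (\<Sum>y\<in>balls_in m' S. monomial g y * cost_upto g n (continue s True) y)"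
        using Suc.prems add_one_in_balls_in[OF _ True] all_found_hit[where s = s, OF sk] m
        by (intro Suc.IH) blast
      from mult_left_mono[OF this pos[of k]]
      have hit: "g k * (real m' * hom_sym g m S) + g k * g k * hom_sym g m' S
          \<le> (\<Sum>y\<in>balls_in m' S. monomial g (add_one k y) * cost_upto g (Suc n) s (add_one k y))"
        unfolding sum_monomial_hit[where s = s, OF sk] by (simp add: m algebra_simps)
      have split: "hom_sym g (Suc m) S = g k * hom_sym g m S + hom_sym g (Suc m) (S - {k})"
        "hom_sym g m S = g k * hom_sym g m' S + hom_sym g m (S - {k})"
        using hom_sym_split[OF True] m by auto
      have "real m * hom_sym g (Suc m) S =
          g k * (real m' * hom_sym g m S) + g k * g k * hom_sym g m' S +
          (real m * hom_sym g (Suc m) (S - {k}) + g k * hom_sym g m (S - {k}))"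
        unfolding split(1) using split(2) m by (simp add: algebra_simps)
      also have "\<dots> \<le> (\<Sum>x\<in>balls_in m S. monomial g x * cost_upto g (Suc n) s x)"
        using hit miss[of "S - {k}"] m
        by (simp add: sum_balls_in_split[OF True] del: cost_upto.simps)
      finally show ?thesis .
    qed
  qed
qed

text \<open>One ball is certainly in \<open>d\<close>, and the position of the other has weight equal to its box cost.
  Opening \<open>d\<close> leaves a one-ball search with monomial weights. Opening another box \<open>k\<close> either finds
  the second ball, after which exactly \<open>g d\<close> must still be paid, or reduces the problem to
  \<open>S - {k}\<close>. Both kinds of opening meet the bound with equality.\<close>

lemma anchored_search_ge:
  assumes pos: "\<And>k. g k > 0" and d: "d \<in> S"
  shows "(\<And>x. x \<in> balls_in 1 S \<Longrightarrow> all_found s (add_one d x) n) \<Longrightarrow>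
    g d * hom_sym g 1 S + hom_sym g 2 S
      \<le> (\<Sum>x\<in>balls_in 1 S. monomial g x * cost_upto g n s (add_one d x))"
  using d
proof (induction n arbitrary: S s)
  case 0
  have "add_one d no_balls \<in> balls_in 1 S"
    using add_one_in_balls_in[of no_balls 0 S d] 0 by (simp add: balls_in_0)
  from "0.prems"(1)[OF this] show ?case
    using add_one_pos[of d "add_one d no_balls"] by (metis all_found_0 less_irrefl)
next
  case (Suc n)
  define k where "k = s []"
  note sk = k_def[symmetric]
  have nonneg: "\<And>k. g k \<ge> 0"
    using pos less_imp_le by blast
  have miss: "g d * hom_sym g 1 T + hom_sym g 2 T + g k * hom_sym g 1 T
      \<le> (\<Sum>x\<in>balls_in 1 T. monomial g x * cost_upto g (Suc n) s (add_one d x))"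
    if T: "T \<subseteq> S" "k \<notin> T" "d \<in> T" for T
  proof -
    have k0: "add_one d x k = 0" if "x \<in> balls_in 1 T" for x
      using that T(2,3) by (auto simp: balls_in_def add_one_def)
    have later: "all_found s (add_one d x) (Suc n) \<longleftrightarrow> all_found (continue s False) (add_one d x) n"
      if "x \<in> balls_in 1 T" for x
      using sk k0[OF that] by (rule all_found_miss)
    have "g d * hom_sym g 1 T + hom_sym g 2 T
        \<le> (\<Sum>x\<in>balls_in 1 T. monomial g x * cost_upto g n (continue s False) (add_one d x))"
      using Suc.prems(1) balls_in_mono[OF T(1)] later T(3)
      by (intro Suc.IH) blast+
    moreover have "\<exists>j. add_one d x j \<noteq> 0" for x
      using add_one_pos[of d x] by (metis less_irrefl)
    ultimately show ?thesis
      using sum_cost_miss[where s = s, OF sk, of "balls_in 1 T" "add_one d"] k0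
      by (simp add: hom_sym_def del: cost_upto.simps)
  qed
  consider (anchor) "k = d" | (other) "k \<in> S" "k \<noteq> d" | (outside) "k \<notin> S" by blast
  then show ?case
  proof cases
    case anchor
    have "real 1 * hom_sym g (Suc 1) S
        \<le> (\<Sum>y\<in>balls_in 1 S. monomial g y * cost_upto g n (continue s True) y)"
      using Suc.prems(1) all_found_hit[where s = s, OF sk] anchor
      by (intro monomial_search_ge nonneg) blast
    then show ?thesis
      using sum_cost_hit[where s = s, OF sk, where f = "\<lambda>x. x" and Y = "balls_in 1 S"] anchor
      by (simp add: hom_sym_def numeral_2_eq_2 del: cost_upto.simps)
  next
    case other
    have pair: "all_found (continue s True) (add_one d no_balls) n"
      using Suc.prems(1)[of "add_one k no_balls"] add_one_in_balls_in[of no_balls 0 S k] other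
        all_found_hit[where s = s, OF sk] add_one_commute[of d k]
      by (simp add: balls_in_0)
    have "real 1 * hom_sym g (Suc 1) {d}
        \<le> (\<Sum>x\<in>balls_in 1 {d}. monomial g x * cost_upto g n (continue s True) x)"
    proof (intro monomial_search_ge nonneg)
      fix x assume "x \<in> balls_in 1 {d}"
      then have "x = add_one d no_balls"
        by (simp add: balls_in_split[of d] balls_in_0 balls_in_empty)
      with pair show "all_found (continue s True) x n" by simp
    qed
    then have "g d * g d \<le> g d * cost_upto g n (continue s True) (add_one d no_balls)"
      by (simp add: hom_sym_split[of d] sum_balls_in_split[of d] balls_in_empty)
    then have tail: "g d \<le> cost_upto g n (continue s True) (add_one d no_balls)"
      using pos[of d] by simp
    have "cost_upto g (Suc n) s (add_one d (add_one k no_balls)) =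
        g k + cost_upto g n (continue s True) (add_one d no_balls)"
      using sum_cost_hit[where s = s, OF sk, where w = "\<lambda>_. 1" and f = "\<lambda>_. add_one d no_balls" and Y = "{()}" and g = g and n = n]
      by (simp add: add_one_commute[of d k] del: cost_upto.simps)
    with tail have "g k * (g k + g d) \<le> g k * cost_upto g (Suc n) s (add_one d (add_one k no_balls))"
      using nonneg[of k] by (intro mult_left_mono) simp_all
    then show ?thesis
      using miss[of "S - {k}"] other Suc.prems(2) hom_sym_split[OF other(1), of g 0]
        hom_sym_split[OF other(1), of g 1] sum_balls_in_split[OF other(1), of _ 0]
      by (simp add: numeral_2_eq_2 algebra_simps del: cost_upto.simps)
  next
    case outside
    then show ?thesis
      using miss[of S] Suc.prems(2) mult_nonneg_nonneg[OF nonneg[of k] hom_sym_nonneg[of g 1 S, OF nonneg]]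
      by simp
  qed
qed


text \<open>Monomial weights for two balls, except that both balls are never together in \<open>d\<close>. The correction
  to the potential \<open>2 * hom_sym g 3 S\<close> is what makes the recursion exact again: a success in \<open>d\<close>
  now shows that the other ball is outside \<open>d\<close>, and once \<open>d\<close> is known to be empty the
  exclusion has no further effect.\<close>

lemma excluded_search_ge:
  fixes d :: box
  defines "dd \<equiv> add_one d (add_one d no_balls)"
  assumes pos: "\<And>k. g k \<ge> 0"
  shows "(\<And>x. x \<in> balls_in 2 S \<Longrightarrow> x \<noteq> dd \<Longrightarrow> all_found s x n) \<Longrightarrow>
    2 * hom_sym g 3 S - of_bool (d \<in> S) * (g d)\<^sup>2 * (hom_sym g 1 S + g d)
      \<le> (\<Sum>x\<in>balls_in 2 S. (if x = dd then 0 else monomial g x) * cost_upto g n s x)"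
proof (induction n arbitrary: S s)
  case 0
  (* A box other than d could hold both balls, and they cannot be found without any opening. *)
  have "S \<subseteq> {d}"
  proof
    fix k assume "k \<in> S"
    then have "add_one k (add_one k no_balls) \<in> balls_in 2 S"
      using add_one_in_balls_in[of "add_one k no_balls" 1 S k] add_one_in_balls_in[of no_balls 0 S k]
      by (simp add: balls_in_0 numeral_2_eq_2)
    moreover have "\<not> all_found s (add_one k (add_one k no_balls)) 0"
      using add_one_pos[of k "add_one k no_balls"] by (metis all_found_0 less_irrefl)
    ultimately have "add_one k (add_one k no_balls) = dd"
      using 0 by blast
    then show "k \<in> {d}"
      by (auto simp: dd_def add_one_def fun_eq_iff split: if_splits)
  qed
  then consider "S = {}" | "S = {d}" by blast
  then show ?case
    by cases (simp_all add: numeral_3_eq_3 hom_sym_split[of d] power2_eq_square)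
next
  case (Suc n)
  define k where "k = s []"
  note sk = k_def[symmetric]
  let ?w = "\<lambda>x. if x = dd then 0 else monomial g x"
  note num = numeral_2_eq_2 numeral_3_eq_3
  have dd_in: "dd \<in> balls_in 2 T \<longleftrightarrow> d \<in> T" for T
    using sum_add_one[of d no_balls] sum_add_one[of d "add_one d no_balls"]
    by (auto simp: dd_def balls_in_def add_one_def split: if_splits)
  have mass: "(\<Sum>x\<in>balls_in 2 T. ?w x) = hom_sym g 2 T - of_bool (d \<in> T) * (g d)\<^sup>2" for T
  proof -
    have "?w x = monomial g x - (if x = dd then (g d)\<^sup>2 else 0)" for x
      by (simp add: dd_def power2_eq_square)
    then show ?thesis
      by (simp add: sum_subtractf hom_sym_def dd_in)
  qed
  have miss: "2 * hom_sym g 3 T - of_bool (d \<in> T) * (g d)\<^sup>2 * (hom_sym g 1 T + g d) +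
      g k * (hom_sym g 2 T - of_bool (d \<in> T) * (g d)\<^sup>2)
      \<le> (\<Sum>x\<in>balls_in 2 T. ?w x * cost_upto g (Suc n) s x)"
    if T: "T \<subseteq> S" "k \<notin> T" for T
  proof -
    have k0: "x k = 0" if "x \<in> balls_in 2 T" for x
      using that T(2) by (auto simp: balls_in_def)
    have later: "all_found s x (Suc n) \<longleftrightarrow> all_found (continue s False) x n"
      if "x \<in> balls_in 2 T" for x
      using sk k0[OF that] by (rule all_found_miss)
    have "2 * hom_sym g 3 T - of_bool (d \<in> T) * (g d)\<^sup>2 * (hom_sym g 1 T + g d)
        \<le> (\<Sum>x\<in>balls_in 2 T. ?w x * cost_upto g n (continue s False) x)"
      using Suc.prems balls_in_mono[OF T(1)] later
      by (intro Suc.IH) blast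
    moreover have "(\<Sum>x\<in>balls_in 2 T. ?w x * cost_upto g (Suc n) s x) =
        g k * (\<Sum>x\<in>balls_in 2 T. ?w x) +
        (\<Sum>x\<in>balls_in 2 T. ?w x * cost_upto g n (continue s False) x)"
      using k0 balls_in_nonzero[of _ 1 T]
      by (intro sum_cost_miss[where f = "\<lambda>x. x"] sk) (auto simp: num)
    ultimately show ?thesis
      unfolding mass by linarith
  qed
  have one_ball: "hom_sym g 2 T
      \<le> (\<Sum>y\<in>balls_in 1 T. monomial g y * cost_upto g n (continue s True) y)"
    if T: "T \<subseteq> S" "k \<in> S" "k \<noteq> d \<or> d \<notin> T" for T
  proof -
    have "real 1 * hom_sym g (Suc 1) T
        \<le> (\<Sum>y\<in>balls_in 1 T. monomial g y * cost_upto g n (continue s True) y)"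
    proof (intro monomial_search_ge pos)
      fix y assume y: "y \<in> balls_in 1 T"
      then have "add_one k y \<in> balls_in 2 S"
        using add_one_in_balls_in[of y 1 S k] balls_in_mono[OF T(1)] T(2) by (auto simp: num)
      moreover have "add_one k y \<noteq> dd"
      proof
        assume eq: "add_one k y = dd"
        then have "k = d"
          using add_one_pos[of k y] by (auto simp: dd_def add_one_def split: if_splits)
        moreover from this have "y d \<noteq> 0"
          using fun_cong[OF eq, of d] by (simp add: dd_def add_one_def)
        ultimately show False
          using T(3) y by (auto simp: balls_in_def)
      qed
      ultimately show "all_found (continue s True) y n"
        using Suc.prems all_found_hit[where s = s, OF sk] by blast
    qed
    then show ?thesis by (simp add: num)
  qed
  show ?case
  proof (cases "k \<in> S")
    case False
    have "0 \<le> (\<Sum>x\<in>balls_in 2 S. ?w x)"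
      using pos unfolding monomial_def by (intro sum_nonneg) (auto intro!: prod_nonneg)
    with False miss[of S] mult_nonneg_nonneg[OF pos[of k]] show ?thesis
      unfolding mass by fastforce
  next
    case True
    note H = hom_sym_split[OF True, of g 0] hom_sym_split[OF True, of g 1] hom_sym_split[OF True, of g 2]
    have split: "(\<Sum>x\<in>balls_in 2 S. ?w x * cost_upto g (Suc n) s x) =
        (\<Sum>y\<in>balls_in 1 S. ?w (add_one k y) * cost_upto g (Suc n) s (add_one k y)) +
        (\<Sum>x\<in>balls_in 2 (S - {k}). ?w x * cost_upto g (Suc n) s x)"
      using sum_balls_in_split[OF True, of _ 1] by (simp add: num del: cost_upto.simps)
    show ?thesis
    proof (cases "k = d")
      case False
      have "dd k = 0"
        using False by (simp add: dd_def add_one_def)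
      then have "add_one k y \<noteq> dd" for y
        using add_one_pos[of k y] by (metis less_irrefl)
      then have "(\<Sum>y\<in>balls_in 1 S. ?w (add_one k y) * cost_upto g (Suc n) s (add_one k y)) =
          g k * (\<Sum>y\<in>balls_in 1 S. monomial g y * cost_upto g (Suc n) s (add_one k y))"
        by (simp add: sum_distrib_left mult.assoc del: cost_upto.simps)
      moreover have "g k * (g k * hom_sym g 1 S + hom_sym g 2 S) \<le>
          g k * (\<Sum>y\<in>balls_in 1 S. monomial g y * cost_upto g (Suc n) s (add_one k y))"
        using one_ball[of S] True False pos[of k]
          sum_cost_hit[where s = s, OF sk, where f = "\<lambda>x. x" and Y = "balls_in 1 S" and w = "monomial g"]
        by (intro mult_left_mono) (simp_all add: hom_sym_def del: cost_upto.simps)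
      ultimately have "g k * (g k * hom_sym g 1 S + hom_sym g 2 S) \<le>
          (\<Sum>y\<in>balls_in 1 S. ?w (add_one k y) * cost_upto g (Suc n) s (add_one k y))"
        by linarith
      moreover have "2 * hom_sym g 3 S - of_bool (d \<in> S) * (g d)\<^sup>2 * (hom_sym g 1 S + g d) =
          g k * (g k * hom_sym g 1 S + hom_sym g 2 S) +
          (2 * hom_sym g 3 (S - {k}) -
            of_bool (d \<in> S - {k}) * (g d)\<^sup>2 * (hom_sym g 1 (S - {k}) + g d) +
            g k * (hom_sym g 2 (S - {k}) - of_bool (d \<in> S - {k}) * (g d)\<^sup>2))"
        using H False by (simp add: num algebra_simps)
      ultimately show ?thesis
        using miss[of "S - {k}"] split by force
    next
      case d: True
      have "dd d = 2"
        by (simp add: dd_def add_one_def)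
      then have other: "add_one d y \<noteq> dd" if "y \<in> balls_in 1 (S - {d})" for y
        using that by (auto simp: add_one_def balls_in_def fun_upd_def)
      have "(\<Sum>y\<in>balls_in 1 S. ?w (add_one d y) * cost_upto g (Suc n) s (add_one d y)) =
          (\<Sum>y\<in>balls_in 1 (S - {d}). ?w (add_one d y) * cost_upto g (Suc n) s (add_one d y))"
        using sum_balls_in_split[of d S _ 0] True d by (simp add: dd_def del: cost_upto.simps)
      also have "\<dots> = g d * (\<Sum>y\<in>balls_in 1 (S - {d}). monomial g y * cost_upto g (Suc n) s (add_one d y))"
        unfolding sum_distrib_left using other
        by (intro sum.cong) (simp_all add: mult.assoc del: cost_upto.simps)
      finally have "(\<Sum>y\<in>balls_in 1 S. ?w (add_one d y) * cost_upto g (Suc n) s (add_one d y)) =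
          g d * (\<Sum>y\<in>balls_in 1 (S - {d}). monomial g y * cost_upto g (Suc n) s (add_one d y))" .
      moreover have "g d * (g d * hom_sym g 1 (S - {d}) + hom_sym g 2 (S - {d})) \<le>
          g d * (\<Sum>y\<in>balls_in 1 (S - {d}). monomial g y * cost_upto g (Suc n) s (add_one d y))"
        using one_ball[of "S - {d}"] True d pos[of d]
          sum_cost_hit[where s = s, OF sk, where f = "\<lambda>x. x" and Y = "balls_in 1 (S - {d})" and w = "monomial g"]
        by (intro mult_left_mono) (auto simp: hom_sym_def simp del: cost_upto.simps)
      ultimately have "g d * (g d * hom_sym g 1 (S - {d}) + hom_sym g 2 (S - {d})) \<le>
          (\<Sum>y\<in>balls_in 1 S. ?w (add_one k y) * cost_upto g (Suc n) s (add_one k y))"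
        unfolding d by linarith
      moreover have "2 * hom_sym g 3 S - of_bool (d \<in> S) * (g d)\<^sup>2 * (hom_sym g 1 S + g d) =
          g d * (g d * hom_sym g 1 (S - {d}) + hom_sym g 2 (S - {d})) +
          (2 * hom_sym g 3 (S - {d}) + g d * hom_sym g 2 (S - {d}))"
        using H True unfolding d by (simp add: num algebra_simps)
      ultimately show ?thesis
        using miss[of "S - {d}"] split unfolding d by simp
    qed
  qed
qed

section \<open>The three Hider distributions\<close>

lemma place_eq_iff [simp]: "place i j k = place i' j' k' \<longleftrightarrow> i = i' \<and> j = j' \<and> k = k'"
  by (metis place.simps)

lemma no_balls_eq_place: "no_balls = place 0 0 0"
proof
  show "no_balls k = place 0 0 0 k" for k by (cases k) auto
qed

lemma place_upd [simp]:
  "(place i j k)(BoxA := n) = place n j k"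
  "(place i j k)(BoxB := n) = place i n k"
  "(place i j k)(BoxC := n) = place i j n"
proof -
  have "((place i j k)(BoxA := n)) l = place n j k l"
    "((place i j k)(BoxB := n)) l = place i n k l"
    "((place i j k)(BoxC := n)) l = place i j n l" for l
    by (cases l; simp)+
  then show "(place i j k)(BoxA := n) = place n j k"
    "(place i j k)(BoxB := n) = place i n k"
    "(place i j k)(BoxC := n) = place i j n" by blast+
qed

lemma place_empty_iff: "(\<forall>l. place i j k l = 0) \<longleftrightarrow> i = 0 \<and> j = 0 \<and> k = 0"
  by (metis box.exhaust place.simps)

lemma monomial_place: "monomial (box_cost a b c) (place i j k) = a ^ i * b ^ j * c ^ k"
  by (simp add: monomial_def UNIV_box mult.assoc)

lemma balls_in_1_UNIV: "balls_in 1 UNIV = {place 1 0 0, place 0 1 0, place 0 0 1}"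
  by (simp add: UNIV_box balls_in_split[of BoxA "{BoxA, BoxB, BoxC}"]
      balls_in_split[of BoxB "{BoxB, BoxC}"] balls_in_split[of BoxC "{BoxC}"]
      balls_in_0 balls_in_empty no_balls_eq_place add_one_def insert_commute)

lemma balls_in_2_UNIV: "balls_in 2 UNIV = placements"
  unfolding placements_def UNIV_box numeral_2_eq_2
  by (simp add: balls_in_split[of BoxA "{BoxA, BoxB, BoxC}"]
      balls_in_split[of BoxB "{BoxB, BoxC}"] balls_in_split[of BoxC "{BoxC}"]
      balls_in_0 balls_in_empty no_balls_eq_place add_one_def insert_commute)

lemma hom_sym_box:
  "hom_sym (box_cost a b c) 1 UNIV = T1 a b c"
  "hom_sym (box_cost a b c) 2 UNIV = T2 a b c"
  "hom_sym (box_cost a b c) 3 UNIV = T3 a b c"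
  unfolding UNIV_box numeral_2_eq_2 numeral_3_eq_3
  by (simp_all add: hom_sym_split[of BoxA "{BoxA, BoxB, BoxC}"]
      hom_sym_split[of BoxB "{BoxB, BoxC}"] hom_sym_split[of BoxC "{BoxC}"]
      T1_def T2_def T3_def algebra_simps power2_eq_square power3_eq_cube)

lemma sum_placements:
  "(\<Sum>x\<in>placements. f x) = f (place 0 0 2) + (f (place 0 1 1) + (f (place 0 2 0) +
    (f (place 1 0 1) + (f (place 1 1 0) + f (place 2 0 0)))))"
  for f :: "placement \<Rightarrow> 'a::comm_monoid_add"
  by (simp add: placements_def)

lemma finite_placements: "finite placements"
  by (simp add: placements_def)

lemma all_found_mono:
  assumes "all_found s x n" "n \<le> m"
  shows "all_found s x m"
proof -
  have "snd (play s x (Suc n)) k \<le> snd (play s x n) k" for n k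
    by (auto simp: Let_def split: prod.splits)
  then have "snd (play s x m) k \<le> snd (play s x n) k" for k
    using assms(2) by (rule lift_Suc_antimono_le)
  then show ?thesis
    using assms(1) unfolding all_found_def by (metis le_zero_eq)
qed

text \<open>It suffices to bound truncated costs of deterministic policies that clear every placement of
  positive weight within a common number of openings. Any other policy has infinite cost with
  positive probability, and a bound that holds for every deterministic policy survives
  integration over a mixed one.\<close>

lemma expected_cost_ge:
  assumes cost: "a \<ge> 0" "b \<ge> 0" "c \<ge> 0"
    and h: "\<And>x. h x \<ge> 0"
    and bound: "\<And>s n. (\<And>x. x \<in> placements \<Longrightarrow> h x > 0 \<Longrightarrow> all_found s x n) \<Longrightarrow>
      v \<le> (\<Sum>x\<in>placements. h x * cost_upto (box_cost a b c) n s x)"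
    and S: "S \<in> searcher_mixed"
  shows "ennreal v \<le> expected_cost a b c S h"
proof -
  interpret prob_space S
    using S by (simp add: searcher_mixed_def)
  have meas [measurable]: "(\<lambda>s. search_cost a b c s x) \<in> borel_measurable S" for x
    using S measurable_search_cost measurable_cong_sets[of S policy_space borel borel]
    unfolding searcher_mixed_def by blast
  have pure: "ennreal v \<le> (\<Sum>x\<in>placements. ennreal (h x) * search_cost a b c s x)" for s
  proof (cases "\<forall>x\<in>placements. h x > 0 \<longrightarrow> (\<exists>n. all_found s x n)")
    case True
    then obtain N where N: "\<And>x. x \<in> placements \<Longrightarrow> h x > 0 \<Longrightarrow> all_found s x (N x)"
      by metis
    have found: "all_found s x (Max (N ` placements))" if "x \<in> placements" "h x > 0" for x
      using finite_placements that by (intro all_found_mono[OF N[OF that]] Max_ge) auto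
    let ?J = "\<lambda>x. h x * cost_upto (box_cost a b c) (Max (N ` placements)) s x"
    have eq: "ennreal (h x) * search_cost a b c s x = ennreal (?J x) \<and> 0 \<le> ?J x"
      if "x \<in> placements" for x
    proof (cases "h x > 0")
      case True
      from search_cost_eq_cost_upto[OF cost found[OF that True]] h[of x] show ?thesis
        by (simp add: ennreal_mult)
    next
      case False
      with h[of x] have "h x = 0" by simp
      then show ?thesis by simp
    qed
    have "ennreal v \<le> ennreal (\<Sum>x\<in>placements. ?J x)"
      using found by (intro ennreal_leI bound)
    also have "\<dots> = (\<Sum>x\<in>placements. ennreal (?J x))"
      using eq by (intro sum_ennreal[symmetric]) blast
    also have "\<dots> = (\<Sum>x\<in>placements. ennreal (h x) * search_cost a b c s x)"
      using eq by (intro sum.cong) auto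
    finally show ?thesis .
  next
    case False
    then obtain x where x: "x \<in> placements" "h x > 0" "\<not> (\<exists>n. all_found s x n)"
      by blast
    then have "ennreal (h x) * search_cost a b c s x = \<infinity>"
      by (auto simp: search_cost_def ennreal_mult_top)
    moreover have "ennreal (h x) * search_cost a b c s x
        \<le> (\<Sum>x\<in>placements. ennreal (h x) * search_cost a b c s x)"
      using x(1) finite_placements by (intro member_le_sum) auto
    ultimately show ?thesis by (simp add: top_unique)
  qed
  have "ennreal v = (\<integral>\<^sup>+ s. ennreal v \<partial>S)"
    by (simp add: emeasure_space_1)
  also have "\<dots> \<le> (\<integral>\<^sup>+ s. (\<Sum>x\<in>placements. ennreal (h x) * search_cost a b c s x) \<partial>S)"
    by (intro nn_integral_mono pure)
  also have "\<dots> = expected_cost a b c S h"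
    unfolding expected_cost_def by (simp add: nn_integral_sum nn_integral_cmult)
  finally show ?thesis .
qed

lemma hider_mixed_h:
  assumes "a > 0" "b > 0" "c > 0"
  shows "h1 a b c \<in> hider_mixed" "h2 a b c \<in> hider_mixed" "h3 a b c \<in> hider_mixed"
proof -
  have pos: "T1 a b c > 0" "T2 a b c - c^2 > 0" "T2 a b c > 0"
    using assms by (simp_all add: T1_def T2_def add_pos_pos)
  have "(\<Sum>x\<in>placements. h1 a b c x) = (c + (b + a)) / T1 a b c"
    "(\<Sum>x\<in>placements. h2 a b c x) = (b*c + (b^2 + (a*c + (a*b + a^2)))) / (T2 a b c - c^2)"
    "(\<Sum>x\<in>placements. h3 a b c x) = (c^2 + (b*c + (b^2 + (a*c + (a*b + a^2))))) / T2 a b c"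
    by (simp_all add: sum_placements h1_def h2_def h3_def hider_vec_def add_divide_distrib)
  moreover have "c + (b + a) = T1 a b c" "b*c + (b^2 + (a*c + (a*b + a^2))) = T2 a b c - c^2"
    "c^2 + (b*c + (b^2 + (a*c + (a*b + a^2)))) = T2 a b c"
    by (simp_all add: T1_def T2_def)
  moreover have "h1 a b c x \<ge> 0" "h2 a b c x \<ge> 0" "h3 a b c x \<ge> 0" for x
    using assms pos by (simp_all add: h1_def h2_def h3_def hider_vec_def)
  moreover have "h1 a b c x = 0" "h2 a b c x = 0" "h3 a b c x = 0" if "x \<notin> placements" for x
    using that by (simp_all add: h1_def h2_def h3_def hider_vec_def placements_def)
  ultimately show "h1 a b c \<in> hider_mixed" "h2 a b c \<in> hider_mixed" "h3 a b c \<in> hider_mixed"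
    using pos by (simp_all add: hider_mixed_def)
qed

lemma expected_cost_h1:
  assumes "a > 0" "b > 0" "c > 0" "S \<in> searcher_mixed"
  shows "ennreal (V1 a b c) \<le> expected_cost a b c S (h1 a b c)"
proof (rule expected_cost_ge)
  fix s n
  assume found: "\<And>x. x \<in> placements \<Longrightarrow> h1 a b c x > 0 \<Longrightarrow> all_found s x n"
  let ?g = "box_cost a b c"
  have T1: "T1 a b c > 0"
    using assms by (simp add: T1_def)
  have "?g BoxA * hom_sym ?g 1 UNIV + hom_sym ?g 2 UNIV
      \<le> (\<Sum>x\<in>balls_in 1 UNIV. monomial ?g x * cost_upto ?g n s (add_one BoxA x))"
  proof (rule anchored_search_ge)
    show "?g k > 0" for k using assms by (cases k) auto
    fix x assume "x \<in> balls_in 1 UNIV"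
    then show "all_found s (add_one BoxA x) n"
      unfolding balls_in_1_UNIV using assms T1
      by (auto intro!: found simp: add_one_def placements_def h1_def hider_vec_def)
  qed simp
  then have "(a * T1 a b c + T2 a b c) / T1 a b c
      \<le> (\<Sum>x\<in>balls_in 1 UNIV. monomial ?g x * cost_upto ?g n s (add_one BoxA x)) / T1 a b c"
    using T1 unfolding hom_sym_box by (intro divide_right_mono) auto
  also have "\<dots> = (\<Sum>x\<in>placements. h1 a b c x * cost_upto ?g n s x)"
    unfolding balls_in_1_UNIV sum_placements
    by (simp add: h1_def hider_vec_def add_one_def monomial_place add_divide_distrib)
       (simp add: numeral_2_eq_2)
  finally show "V1 a b c \<le> (\<Sum>x\<in>placements. h1 a b c x * cost_upto ?g n s x)"
    using T1 by (simp add: V1_def add_divide_distrib)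
qed (use assms hider_mixed_h[of a b c] in \<open>auto simp: hider_mixed_def\<close>)

lemma expected_cost_h2:
  assumes "a > 0" "b > 0" "c > 0" "S \<in> searcher_mixed"
  shows "ennreal (V2 a b c) \<le> expected_cost a b c S (h2 a b c)"
proof (rule expected_cost_ge)
  fix s n
  assume found: "\<And>x. x \<in> placements \<Longrightarrow> h2 a b c x > 0 \<Longrightarrow> all_found s x n"
  let ?g = "box_cost a b c" and ?cc = "add_one BoxC (add_one BoxC no_balls)"
  have cc: "?cc = place 0 0 2"
    by (simp add: no_balls_eq_place add_one_def)
  have D: "T2 a b c - c^2 > 0"
    using assms by (simp add: T2_def add_pos_pos)
  have "2 * hom_sym ?g 3 UNIV - of_bool (BoxC \<in> UNIV) * (?g BoxC)\<^sup>2 * (hom_sym ?g 1 UNIV + ?g BoxC)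
      \<le> (\<Sum>x\<in>balls_in 2 UNIV. (if x = ?cc then 0 else monomial ?g x) * cost_upto ?g n s x)"
  proof (rule excluded_search_ge)
    show "?g k \<ge> 0" for k using assms by (cases k) auto
    fix x assume "x \<in> balls_in 2 UNIV" "x \<noteq> ?cc"
    then show "all_found s x n"
      unfolding balls_in_2_UNIV cc using assms D
      by (intro found) (auto simp: placements_def h2_def hider_vec_def)
  qed
  then have "V2 a b c
      \<le> (\<Sum>x\<in>placements. (if x = ?cc then 0 else monomial ?g x) * cost_upto ?g n s x) / (T2 a b c - c^2)"
    using D unfolding hom_sym_box balls_in_2_UNIV V2_def
    by (intro divide_right_mono) (auto simp: T1_def algebra_simps)
  also have "\<dots> = (\<Sum>x\<in>placements. h2 a b c x * cost_upto ?g n s x)"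
    unfolding cc sum_placements
    by (simp add: h2_def hider_vec_def monomial_place add_divide_distrib)
  finally show "V2 a b c \<le> (\<Sum>x\<in>placements. h2 a b c x * cost_upto ?g n s x)" .
qed (use assms hider_mixed_h[of a b c] in \<open>auto simp: hider_mixed_def\<close>)

lemma expected_cost_h3:
  assumes "a > 0" "b > 0" "c > 0" "S \<in> searcher_mixed"
  shows "ennreal (V3 a b c) \<le> expected_cost a b c S (h3 a b c)"
proof (rule expected_cost_ge)
  fix s n
  assume found: "\<And>x. x \<in> placements \<Longrightarrow> h3 a b c x > 0 \<Longrightarrow> all_found s x n"
  let ?g = "box_cost a b c"
  have T2: "T2 a b c > 0"
    using assms by (simp add: T2_def add_pos_pos)
  have "real 2 * hom_sym ?g (Suc 2) UNIV \<le> (\<Sum>x\<in>balls_in 2 UNIV. monomial ?g x * cost_upto ?g n s x)"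
  proof (rule monomial_search_ge)
    show "?g k \<ge> 0" for k using assms by (cases k) auto
    fix x assume "x \<in> balls_in 2 UNIV"
    then show "all_found s x n"
      unfolding balls_in_2_UNIV using assms T2
      by (intro found) (auto simp: placements_def h3_def hider_vec_def)
  qed
  then have "2 * hom_sym ?g 3 UNIV \<le> (\<Sum>x\<in>placements. monomial ?g x * cost_upto ?g n s x)"
    unfolding balls_in_2_UNIV by simp
  then have "V3 a b c \<le> (\<Sum>x\<in>placements. monomial ?g x * cost_upto ?g n s x) / T2 a b c"
    using T2 unfolding hom_sym_box V3_def by (intro divide_right_mono) auto
  also have "\<dots> = (\<Sum>x\<in>placements. h3 a b c x * cost_upto ?g n s x)"
    unfolding sum_placements
    by (simp add: h3_def hider_vec_def monomial_place add_divide_distrib)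
  finally show "V3 a b c \<le> (\<Sum>x\<in>placements. h3 a b c x * cost_upto ?g n s x)" .
qed (use assms hider_mixed_h[of a b c] in \<open>auto simp: hider_mixed_def\<close>)

section \<open>Mixed Searcher strategies\<close>

text \<open>A finite list of policies with probabilities gives a mixed strategy, and a bound on its cost
  against each single placement carries over to every Hider distribution.\<close>

lemma upper_value_le:
  fixes ps :: "(policy \<times> real) list"
  assumes cost: "a \<ge> 0" "b \<ge> 0" "c \<ge> 0"
    and weights: "\<And>s p. (s, p) \<in> set ps \<Longrightarrow> p \<ge> 0" "(\<Sum>(s, p)\<leftarrow>ps. p) = 1"
    and found: "\<And>s p x. (s, p) \<in> set ps \<Longrightarrow> x \<in> placements \<Longrightarrow> all_found s x n"
    and bound: "\<And>x. x \<in> placements \<Longrightarrow>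
      (\<Sum>(s, p)\<leftarrow>ps. p * cost_upto (box_cost a b c) n s x) \<le> v"
  shows "upper_value a b c \<le> ennreal v"
proof -
  let ?I = "{..<length ps}" and ?J = "\<lambda>i x. cost_upto (box_cost a b c) n (fst (ps ! i)) x"
  define P where "P = point_measure ?I (\<lambda>i. ennreal (snd (ps ! i)))"
  define S where "S = distr P policy_space (\<lambda>i. fst (ps ! i))"
  have sum_ps: "(\<Sum>(s, p)\<leftarrow>ps. f s p) = (\<Sum>i\<in>?I. f (fst (ps ! i)) (snd (ps ! i)))"
    for f :: "policy \<Rightarrow> real \<Rightarrow> real"
    by (simp add: sum_list_sum_nth case_prod_beta atLeast0LessThan)
  have nth: "(fst (ps ! i), snd (ps ! i)) \<in> set ps" if "i \<in> ?I" for i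
    using that by simp
  have nonneg: "snd (ps ! i) \<ge> 0" if "i \<in> ?I" for i
    using weights(1)[OF nth[OF that]] .
  have meas: "(\<lambda>i. fst (ps ! i)) \<in> measurable P policy_space"
    unfolding P_def measurable_point_measure_eq1 by (simp add: policy_space_def space_PiM)
  have "emeasure P (space P) = (\<Sum>i\<in>?I. ennreal (snd (ps ! i)))"
    unfolding P_def by (simp add: space_point_measure emeasure_point_measure_finite)
  also have "\<dots> = ennreal 1"
    using nonneg weights(2) sum_ps[of "\<lambda>_ p. p"] by (subst sum_ennreal) auto
  finally have "prob_space P"
    by (intro prob_spaceI) simp
  then have S: "S \<in> searcher_mixed"
    using meas unfolding searcher_mixed_def S_def by (auto intro: prob_space.prob_space_distr)
  have "(\<integral>\<^sup>+ s. search_cost a b c s x \<partial>S) \<le> ennreal v" if x: "x \<in> placements" for x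
  proof -
    have "(\<integral>\<^sup>+ s. search_cost a b c s x \<partial>S) =
        (\<Sum>i\<in>?I. ennreal (snd (ps ! i)) * search_cost a b c (fst (ps ! i)) x)"
      unfolding S_def using meas measurable_search_cost
      by (subst nn_integral_distr) (auto simp: P_def nn_integral_point_measure_finite)
    also have "\<dots> = (\<Sum>i\<in>?I. ennreal (snd (ps ! i) * ?J i x))"
    proof (intro sum.cong refl)
      fix i assume i: "i \<in> ?I"
      from search_cost_eq_cost_upto[OF cost found[OF nth[OF i] x]] nonneg[OF i]
      show "ennreal (snd (ps ! i)) * search_cost a b c (fst (ps ! i)) x =
          ennreal (snd (ps ! i) * ?J i x)"
        by (simp add: ennreal_mult)
    qed
    also have "\<dots> = ennreal (\<Sum>i\<in>?I. snd (ps ! i) * ?J i x)"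
    proof (intro sum_ennreal mult_nonneg_nonneg)
      fix i assume i: "i \<in> ?I"
      show "snd (ps ! i) \<ge> 0" "?J i x \<ge> 0"
        using nonneg[OF i] search_cost_eq_cost_upto[OF cost found[OF nth[OF i] x]] by auto
    qed
    also have "\<dots> \<le> ennreal v"
      using bound[OF x] sum_ps[of "\<lambda>s p. p * cost_upto (box_cost a b c) n s x"]
      by (intro ennreal_leI) simp
    finally show ?thesis .
  qed
  note pure = this
  have "expected_cost a b c S h \<le> ennreal v" if h: "h \<in> hider_mixed" for h
  proof -
    have "expected_cost a b c S h \<le> (\<Sum>x\<in>placements. ennreal (h x) * ennreal v)"
      unfolding expected_cost_def
      using pure by (intro sum_mono mult_left_mono) auto
    also have "\<dots> = (\<Sum>x\<in>placements. ennreal (h x)) * ennreal v"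
      by (simp add: sum_distrib_right)
    also have "(\<Sum>x\<in>placements. ennreal (h x)) = ennreal (\<Sum>x\<in>placements. h x)"
      using h by (intro sum_ennreal) (simp add: hider_mixed_def)
    finally show ?thesis
      using h by (simp add: hider_mixed_def)
  qed
  then show ?thesis
    unfolding upper_value_def using S by (intro INF_lower2[of S] SUP_least) auto
qed

text \<open>All policies that are needed open a fixed first box and then continue in one of two ways according to
  the outcome, or open boxes in a fixed order. The order need only be as long as the
  search that uses it: once all balls are found, the next choice is irrelevant.\<close>

definition sweep :: "box list \<Rightarrow> policy" where
  "sweep ks = (\<lambda>w. ks ! length w)"

fun plan :: "box \<Rightarrow> policy \<Rightarrow> policy \<Rightarrow> policy" where
  "plan k s f [] = k"
| "plan k s f ((_, ok) # w) = (if ok then s w else f w)"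

lemma sweep_Cons [simp]: "sweep (k # ks) [] = k" "continue (sweep (k # ks)) ok = sweep ks"
  by (simp_all add: sweep_def continue_def)

lemma continue_plan [simp]: "continue (plan k s f) ok = (if ok then s else f)"
  by (rule ext) (simp add: continue_def)

lemma all_found_no_balls [simp]: "all_found s (place 0 0 0) n"
  by (rule all_found_mono[of _ _ 0]) (simp_all add: all_found_0 place_empty_iff)

text \<open>Evaluation rules restricted to these policies; unfolding the recursion for an arbitrary policy
  would branch on unknown choices.\<close>

lemma all_found_plan:
  "all_found (plan k s f) x (Suc n) \<longleftrightarrow> all_found (if 0 < x k then s else f) (take_one k x) n"
  "all_found (sweep (k # ks)) x (Suc n) \<longleftrightarrow> all_found (sweep ks) (take_one k x) n"
  by (simp_all add: all_found_Suc)

lemma cost_upto_plan: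
  "cost_upto g (Suc n) (plan k s f) x =
    (if \<forall>j. x j = 0 then 0 else g k + cost_upto g n (if 0 < x k then s else f) (take_one k x))"
  "cost_upto g (Suc n) (sweep (k # ks)) x =
    (if \<forall>j. x j = 0 then 0 else g k + cost_upto g n (sweep ks) (take_one k x))"
  by simp_all

lemma cost_upto_no_balls [simp]: "cost_upto g n s (place 0 0 0) = 0"
  by (rule cost_upto_done) (simp add: place_empty_iff)

text \<open>The Searcher's mixture. With probability \<open>m1 + m2 + m3\<close> she starts with \<open>A\<close>. The order used after a
  success there is \<open>ABC\<close>, \<open>BAC\<close> or \<open>CAB\<close> (weights \<open>m1\<close>, \<open>m2\<close>, \<open>m3\<close>), and the
  plan used after a failure is one of three for the boxes \<open>B\<close> and \<open>C\<close> (weights \<open>f1\<close>, \<open>f2\<close>,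
  \<open>f3\<close>): \<open>B\<close> first and then again \<open>B\<close>, \<open>C\<close> first and then again \<open>C\<close>, or \<open>B\<close> first and then
  \<open>C\<close>, where the second box is the one tried after a success. The two choices
  are made independently, since each placement meets only one of them. With probability \<open>r + t\<close>
  she starts with \<open>B\<close>: after a success she uses the order \<open>BCA\<close> (weight \<open>r\<close>) or \<open>CBA\<close> (weight
  \<open>t\<close>), after a failure she opens \<open>A\<close> or \<open>C\<close> respectively and, if that succeeds, looks for the last
  ball in \<open>C\<close> before \<open>A\<close>. The six bounds are the expected costs against
  \<open>002\<close>, \<open>011\<close>, \<open>020\<close>, \<open>101\<close>, \<open>110\<close> and \<open>200\<close>.\<close>

lemma upper_value_le_mixture:
  fixes a b c V r t :: real
  assumes cost: "a \<ge> 0" "b \<ge> 0" "c \<ge> 0"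
    and nonneg: "r \<ge> 0" "t \<ge> 0" "m1 \<ge> 0" "m2 \<ge> 0" "m3 \<ge> 0" "f1 \<ge> 0" "f2 \<ge> 0" "f3 \<ge> 0"
    and total: "r + t + (m1 + m2 + m3) = 1" "f1 + f2 + f3 = m1 + m2 + m3" "m1 + m2 + m3 > 0"
    and bounds:
      "r*(a + b + 2*c) + t*(b + 2*c) + f1*(a + b + 2*c) + f2*(a + 2*c) + f3*(a + b + 2*c) \<le> V"
      "r*(2*b + c) + t*(b + c) + f1*(a + 2*b + c) + f2*(a + b + 2*c) + f3*(a + b + c) \<le> V"
      "r*(2*b) + t*(2*b + c) + f1*(a + 2*b) + f2*(a + 2*b + c) + f3*(a + 2*b + c) \<le> V"
      "r*(a + b + c) + t*(a + b + 2*c) + m1*(2*a + b + c) + m2*(2*a + b + c) + m3*(a + c) \<le> V"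
      "r*(a + 2*b + c) + t*(a + 2*b + c) + m1*(2*a + b) + m2*(a + b) + m3*(2*a + b + c) \<le> V"
      "r*(2*a + b + c) + t*(2*a + b + c) + m1*(2*a) + m2*(2*a + b) + m3*(2*a + c) \<le> V"
  shows "upper_value a b c \<le> ennreal V"
proof -
  define q where "q = m1 + m2 + m3"
  have q: "q > 0" "f1 + f2 + f3 = q" "m1 + m2 + m3 = q"
    using total by (simp_all add: q_def)
  define o1 o2 o3 where "o1 = sweep [BoxA, BoxB, BoxC]" and "o2 = sweep [BoxB, BoxA, BoxC]"
    and "o3 = sweep [BoxC, BoxA, BoxB]"
  define g1 g2 g3 where "g1 = plan BoxB (sweep [BoxB, BoxC]) (sweep [BoxC, BoxC])"
    and "g2 = plan BoxC (sweep [BoxC, BoxB]) (sweep [BoxB, BoxB])"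
    and "g3 = plan BoxB (sweep [BoxC, BoxB]) (sweep [BoxC, BoxC])"
  define w where "w m f = m * f / q" for m f
  define ps where "ps =
    [(plan BoxB (sweep [BoxB, BoxC, BoxA]) (plan BoxA (sweep [BoxC, BoxA]) (sweep [BoxC, BoxC])), r),
     (plan BoxB (sweep [BoxC, BoxB, BoxA]) (plan BoxC (sweep [BoxC, BoxA]) (sweep [BoxA, BoxA])), t),
     (plan BoxA o1 g1, w m1 f1), (plan BoxA o1 g2, w m1 f2), (plan BoxA o1 g3, w m1 f3),
     (plan BoxA o2 g1, w m2 f1), (plan BoxA o2 g2, w m2 f2), (plan BoxA o2 g3, w m2 f3),
     (plan BoxA o3 g1, w m3 f1), (plan BoxA o3 g2, w m3 f2), (plan BoxA o3 g3, w m3 f3)]"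
  note policies = ps_def o1_def o2_def o3_def g1_def g2_def g3_def
  (* Independence: the marginals of the product weights are the two given weightings. *)
  have row: "w m f1 + w m f2 + w m f3 = m" for m
    using q unfolding w_def by (simp flip: add_divide_distrib distrib_left)
  have col: "w m1 f + w m2 f + w m3 f = f" for f
    using q unfolding w_def by (simp flip: add_divide_distrib distrib_right)
  have four: "4 = Suc (Suc (Suc (Suc 0)))" by simp
  note eval = all_found_plan cost_upto_plan place_empty_iff take_one_def numeral_2_eq_2
  show ?thesis
  proof (rule upper_value_le[OF cost, where ps = ps and n = 4])
    show "p \<ge> 0" if "(s, p) \<in> set ps" for s p
      using that nonneg q(1) by (auto simp: ps_def w_def)
    show "(\<Sum>(s, p)\<leftarrow>ps. p) = 1"
      using row[of m1] row[of m2] row[of m3] total(1) by (simp add: ps_def)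
    show "all_found s x 4" if "(s, p) \<in> set ps" "x \<in> placements" for s p x
      using that unfolding policies placements_def four by (auto simp: eval)
    fix x assume "x \<in> placements"
    then consider "x = place 0 0 2" | "x = place 0 1 1" | "x = place 0 2 0" |
      "x = place 1 0 1" | "x = place 1 1 0" | "x = place 2 0 0"
      unfolding placements_def by blast
    then show "(\<Sum>(s, p)\<leftarrow>ps. p * cost_upto (box_cost a b c) 4 s x) \<le> V"
    proof cases
      case 1
      have "(\<Sum>(s, p)\<leftarrow>ps. p * cost_upto (box_cost a b c) 4 s x) =
          r*(a + b + 2*c) + t*(b + 2*c) +
          (w m1 f1 + w m2 f1 + w m3 f1)*(a + b + 2*c) + (w m1 f2 + w m2 f2 + w m3 f2)*(a + 2*c) + (w m1 f3 + w m2 f3 + w m3 f3)*(a + b + 2*c)"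
        unfolding policies four 1 by (simp add: eval algebra_simps del: cost_upto.simps)
      then show ?thesis
        using bounds(1) unfolding col by simp
    next
      case 2
      have "(\<Sum>(s, p)\<leftarrow>ps. p * cost_upto (box_cost a b c) 4 s x) =
          r*(2*b + c) + t*(b + c) +
          (w m1 f1 + w m2 f1 + w m3 f1)*(a + 2*b + c) + (w m1 f2 + w m2 f2 + w m3 f2)*(a + b + 2*c) + (w m1 f3 + w m2 f3 + w m3 f3)*(a + b + c)"
        unfolding policies four 2 by (simp add: eval algebra_simps del: cost_upto.simps)
      then show ?thesis
        using bounds(2) unfolding col by simp
    next
      case 3
      have "(\<Sum>(s, p)\<leftarrow>ps. p * cost_upto (box_cost a b c) 4 s x) =
          r*(2*b) + t*(2*b + c) +
          (w m1 f1 + w m2 f1 + w m3 f1)*(a + 2*b) + (w m1 f2 + w m2 f2 + w m3 f2)*(a + 2*b + c) + (w m1 f3 + w m2 f3 + w m3 f3)*(a + 2*b + c)"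
        unfolding policies four 3 by (simp add: eval algebra_simps del: cost_upto.simps)
      then show ?thesis
        using bounds(3) unfolding col by simp
    next
      case 4
      have "(\<Sum>(s, p)\<leftarrow>ps. p * cost_upto (box_cost a b c) 4 s x) =
          r*(a + b + c) + t*(a + b + 2*c) +
          (w m1 f1 + w m1 f2 + w m1 f3)*(2*a + b + c) + (w m2 f1 + w m2 f2 + w m2 f3)*(2*a + b + c) + (w m3 f1 + w m3 f2 + w m3 f3)*(a + c)"
        unfolding policies four 4 by (simp add: eval algebra_simps del: cost_upto.simps)
      then show ?thesis
        using bounds(4) unfolding row by simp
    next
      case 5
      have "(\<Sum>(s, p)\<leftarrow>ps. p * cost_upto (box_cost a b c) 4 s x) =
          r*(a + 2*b + c) + t*(a + 2*b + c) +
          (w m1 f1 + w m1 f2 + w m1 f3)*(2*a + b) + (w m2 f1 + w m2 f2 + w m2 f3)*(a + b) + (w m3 f1 + w m3 f2 + w m3 f3)*(2*a + b + c)"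
        unfolding policies four 5 by (simp add: eval algebra_simps del: cost_upto.simps)
      then show ?thesis
        using bounds(5) unfolding row by simp
    next
      case 6
      have "(\<Sum>(s, p)\<leftarrow>ps. p * cost_upto (box_cost a b c) 4 s x) =
          r*(2*a + b + c) + t*(2*a + b + c) +
          (w m1 f1 + w m1 f2 + w m1 f3)*(2*a) + (w m2 f1 + w m2 f2 + w m2 f3)*(2*a + b) + (w m3 f1 + w m3 f2 + w m3 f3)*(2*a + c)"
        unfolding policies four 6 by (simp add: eval algebra_simps del: cost_upto.simps)
      then show ?thesis
        using bounds(6) unfolding row by simp
    qed
  qed
qed


section \<open>Balancing the Searcher\<close>

text \<open>Given \<open>r\<close> and \<open>t\<close>, the weights of the three orders used after a success in \<open>A\<close> are determined by
  their sum and by the requirement that \<open>101\<close> and \<open>110\<close> cost exactly \<open>a + b + c + v\<close>; then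
  \<open>200\<close> costs the same if and only if \<open>two_in_A\<close> holds. The inequalities \<open>orders\<close> say that
  these weights are nonnegative, and \<open>none_in_A\<close> bounds the costs against \<open>002\<close>, \<open>011\<close> and
  \<open>020\<close>.\<close>

lemma upper_value_le_parametric:
  fixes a b c v r t f1 f2 :: real
  defines "p \<equiv> r + t"
  assumes cost: "a > 0" "b > 0" "c > 0"
    and nonneg: "r \<ge> 0" "t \<ge> 0" "f1 \<ge> 0" "f2 \<ge> 0" "f1 + f2 \<le> 1 - p" "p < 1"
    and orders: "p * a \<le> b" "v \<le> (1 - p) * a + t * c" "t * c \<le> v + p * (a - b)"
    and two_in_A: "(a + b + c) * v = a\<^sup>2 - b * c + p * b * (b + c) + t * c\<^sup>2"
    and none_in_A: "c - f2 * b - t * a \<le> v" "f1 * b + f2 * c + r * (b - a) - t * a \<le> v"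
      "b - f1 * c - r * (a + c) - t * a \<le> v"
  shows "upper_value a b c \<le> ennreal (a + b + c + v)"
proof -
  define m1 m2 m3 where "m1 = (v + p * (a - b) - t * c) / (a + b)"
    and "m2 = (b - p * a) / (a + b)" and "m3 = ((1 - p) * a - v + t * c) / (a + b)"
  have ab: "a + b > 0" using cost by simp
  have m: "(a + b) * m1 = v + p * (a - b) - t * c" "(a + b) * m2 = b - p * a"
      "(a + b) * m3 = (1 - p) * a - v + t * c"
    using ab by (simp_all add: m1_def m2_def m3_def)
  have "(a + b) * (m1 + m2 + m3) = (a + b) * (1 - p)"
    unfolding distrib_left m by (simp add: algebra_simps)
  then have total: "m1 + m2 + m3 = 1 - p"
    using ab by simp
  have "(a + b) * (b * m2 + c * m3) = b * ((a + b) * m2) + c * ((a + b) * m3)"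
    by (simp add: algebra_simps)
  also have "\<dots> = (a + b) * (v + b + c - a - p * (b + c))"
    unfolding m using two_in_A by (simp add: algebra_simps power2_eq_square)
  finally have two: "b * m2 + c * m3 = v + b + c - a - p * (b + c)"
    using ab by simp
  have m1: "m1 = 1 - p - m2 - m3" using total by simp
  show ?thesis
  proof (rule upper_value_le_mixture[where r = r and t = t and ?m1.0 = m1 and ?m2.0 = m2
        and ?m3.0 = m3 and ?f1.0 = f1 and ?f2.0 = f2 and ?f3.0 = "1 - p - f1 - f2"])
    show "m1 \<ge> 0" "m2 \<ge> 0" "m3 \<ge> 0"
      using ab orders by (simp_all add: m1_def m2_def m3_def)
  qed (use cost nonneg none_in_A total in \<open>simp_all add: p_def\<close>,
       use none_in_A two m(2,3) in \<open>simp_all add: m1 p_def algebra_simps\<close>)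
qed

text \<open>In this form the weighted means are visible. Once the fraction in \<open>V1\<close> is expanded by \<open>a\<close>, its
  numerator and denominator grow by \<open>b ^ 3\<close> and \<open>b * (b + c)\<close> on the way to \<open>V2\<close>, and those of \<open>V2\<close>
  grow by \<open>c ^ 3\<close> and \<open>c\<^sup>2\<close> on the way to \<open>V3\<close>.\<close>

lemma value_coordinates:
  assumes "a > 0" "b > 0" "c > 0"
  shows "V1 a b c = a + b + c + (a\<^sup>2 - b * c) / (a + b + c)"
    "V2 a b c = a + b + c + (a ^ 3 + b ^ 3 - a * b * c) / (a * (a + b + c) + b * (b + c))"
    "V3 a b c = a + b + c + (a ^ 3 + b ^ 3 + c ^ 3 - a * b * c) / (a * (a + b + c) + (b\<^sup>2 + b * c + c\<^sup>2))"
proof -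
  have D: "T2 a b c - c\<^sup>2 = a * (a + b + c) + b * (b + c)"
    "T2 a b c = a * (a + b + c) + (b\<^sup>2 + b * c + c\<^sup>2)"
    by (simp_all add: T2_def algebra_simps power2_eq_square)
  have pos: "a + b + c > 0" "a * (a + b + c) + b * (b + c) > 0"
    "a * (a + b + c) + (b\<^sup>2 + b * c + c\<^sup>2) > 0"
    using assms by (simp_all add: add_pos_pos)
  show "V1 a b c = a + b + c + (a\<^sup>2 - b * c) / (a + b + c)"
    unfolding V1_def D(2) T1_def using pos(1)
    by (simp add: field_simps power2_eq_square)
  show "V2 a b c = a + b + c + (a ^ 3 + b ^ 3 - a * b * c) / (a * (a + b + c) + b * (b + c))"
    unfolding V2_def D(1) T3_def using pos(2)
    by (simp add: field_simps power2_eq_square power3_eq_cube)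
  show "V3 a b c = a + b + c + (a ^ 3 + b ^ 3 + c ^ 3 - a * b * c) / (a * (a + b + c) + (b\<^sup>2 + b * c + c\<^sup>2))"
    unfolding V3_def D(2) T3_def using pos(3)
    by (simp add: field_simps power2_eq_square power3_eq_cube)
qed

text \<open>If \<open>V1\<close> is largest, starting with \<open>A\<close> always is good enough. The thresholds
  \<open>b\<^sup>2 / (b + c)\<close> and \<open>(b ^ 3 + c ^ 3) / (b\<^sup>2 + b * c + c\<^sup>2)\<close> lie below
  \<open>V1 - (a + b + c)\<close>, which is what the two-ball search of \<open>B\<close> and \<open>C\<close> after a failure in \<open>A\<close>
  needs.\<close>

lemma upper_value_le_V1:
  assumes order: "a \<ge> b" "b \<ge> c" "c > 0"
    and max: "V2 a b c \<le> V1 a b c" "V3 a b c \<le> V1 a b c"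
  shows "upper_value a b c \<le> ennreal (V1 a b c)"
proof -
  define v where "v = (a\<^sup>2 - b * c) / (a + b + c)"
  have pos: "a > 0" "b > 0" "c > 0" "a + b + c > 0" "a * (a + b + c) + b * (b + c) > 0"
    "a * (a + b + c) + (b\<^sup>2 + b * c + c\<^sup>2) > 0"
    using order by (simp_all add: add_pos_pos)
  note V = value_coordinates[OF pos(1-3), folded v_def]
  have v: "(a + b + c) * v = a\<^sup>2 - b * c"
    using pos by (simp add: v_def)
  have N: "a ^ 3 - a * b * c = a * ((a + b + c) * v)"
    unfolding v by (simp add: algebra_simps power2_eq_square power3_eq_cube)
  have "b * b\<^sup>2 \<le> b * (v * (b + c))"
    using max(1) pos(5) N unfolding V
    by (simp add: pos_divide_le_eq algebra_simps power2_eq_square power3_eq_cube)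
  then have one_box: "b\<^sup>2 \<le> v * (b + c)"
    using pos by simp
  have two_boxes: "b ^ 3 + c ^ 3 \<le> v * (b\<^sup>2 + b * c + c\<^sup>2)"
    using max(2) pos(6) N unfolding V
    by (simp add: pos_divide_le_eq algebra_simps power2_eq_square power3_eq_cube)
  have "b * c \<le> a * a" "b * c \<le> b * b"
    using order by (simp_all add: mult_mono)
  have "0 \<le> v"
    using \<open>b * c \<le> a * a\<close> pos by (simp add: v_def power2_eq_square)
  have "v \<le> a"
    unfolding v_def using pos
    by (simp add: pos_divide_le_eq algebra_simps power2_eq_square)
  (* The least weights that keep the costs against 020 and 002 down to the value; each of them makes
     011 more expensive. *)
  define f1 f2 where "f1 = max 0 ((b - v) / c)" and "f2 = max 0 ((c - v) / b)"
  have bal: "f1 + f2 \<le> 1 \<and> f1 * b + f2 * c \<le> v"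
  proof -
    consider "b \<le> v" | "c \<le> v" "v < b" | "v < c" by linarith
    then show ?thesis
    proof cases
      case 1
      then have "f1 = 0" "f2 = 0"
        using order pos by (simp_all add: f1_def f2_def divide_nonpos_pos)
      then show ?thesis using \<open>0 \<le> v\<close> by simp
    next
      case 2
      then have f: "f1 = (b - v) / c" "f2 = 0"
        using pos by (simp_all add: f1_def f2_def divide_nonpos_pos)
      have "(b - c) * (b + c) \<le> b\<^sup>2"
        by (simp add: algebra_simps power2_eq_square)
      with one_box have "(b - c) * (b + c) \<le> v * (b + c)"
        by linarith
      then have "b - c \<le> v"
        using pos by simp
      then show ?thesis
        using one_box pos zero_le_square[of c] unfolding f
        by (simp add: pos_divide_le_eq algebra_simps power2_eq_square)
    next
      case 3
      then have f: "f1 = (b - v) / c" "f2 = (c - v) / b"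
        using order pos by (simp_all add: f1_def f2_def)
      have "b * c * (f1 + f2) = b * (b - v) + c * (c - v)"
        "b * c * (f1 * b + f2 * c) = b\<^sup>2 * (b - v) + c\<^sup>2 * (c - v)"
        unfolding f using pos by (simp_all add: field_simps power2_eq_square)
      moreover have "c * c \<le> b * c"
        using order by simp
      then have "b * (b - v) + c * (c - v) \<le> b * c"
        using one_box by (simp add: algebra_simps power2_eq_square)
      moreover have "b\<^sup>2 * (b - v) + c\<^sup>2 * (c - v) \<le> b * c * v"
        using two_boxes by (simp add: algebra_simps power2_eq_square power3_eq_cube)
      ultimately have "b * c * (f1 + f2) \<le> b * c * 1" "b * c * (f1 * b + f2 * c) \<le> b * c * v"
        by simp_all
      then show ?thesis
        using mult_le_cancel_left_pos[of "b * c"] pos by (metis mult_pos_pos)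
    qed
  qed
  have "b - v \<le> f1 * c" "c - v \<le> f2 * b"
    using pos by (simp_all add: f1_def f2_def max_def pos_divide_less_eq not_le divide_le_0_iff)
  then have "upper_value a b c \<le> ennreal (a + b + c + v)"
    using pos v bal \<open>0 \<le> v\<close> \<open>v \<le> a\<close>
    by (intro upper_value_le_parametric[where r = 0 and t = 0 and ?f1.0 = f1 and ?f2.0 = f2])
       (simp_all add: f1_def f2_def)
  then show ?thesis
    by (simp add: V)
qed

text \<open>If \<open>V2\<close> is largest, then \<open>v = V2 - (a + b + c)\<close> lies between \<open>c\<close> and the threshold
  \<open>K = b\<^sup>2 / (b + c)\<close>. Since \<open>v \<ge> c\<close>, the placement \<open>002\<close> is cheap enough for plans that never
  search \<open>C\<close> early, so \<open>t = 0\<close> and \<open>f2 = 0\<close>; the other five placements are equalized. The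
  probability \<open>r\<close> of starting with \<open>B\<close> is proportional to \<open>K - v\<close> and vanishes where \<open>V2\<close> meets
  \<open>V1\<close>.\<close>

lemma upper_value_le_V2:
  assumes order: "a \<ge> b" "b \<ge> c" "c > 0"
    and max: "V1 a b c \<le> V2 a b c" "V3 a b c \<le> V2 a b c"
  shows "upper_value a b c \<le> ennreal (V2 a b c)"
proof -
  let ?T = "a + b + c" and ?D = "a * (a + b + c) + b * (b + c)"
  define v where "v = (a ^ 3 + b ^ 3 - a * b * c) / ?D"
  have pos: "a > 0" "b > 0" "c > 0" "?T > 0" "?D > 0"
    "a * ?T + (b\<^sup>2 + b * c + c\<^sup>2) > 0" "b + c > 0"
    using order by (simp_all add: add_pos_pos)
  note V = value_coordinates[OF pos(1-3), folded v_def]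
  have "?D * v = a ^ 3 + b ^ 3 - a * b * c"
    using pos(5) by (simp add: v_def)
  then have v: "?D * v = a * (a\<^sup>2 - b * c) + b ^ 3"
    by (simp add: algebra_simps power2_eq_square power3_eq_cube)
  have "a\<^sup>2 - b * c \<le> ?T * v"
    using max(1) pos unfolding V by (simp add: pos_divide_le_eq mult.commute)
  from mult_left_mono[OF this, of a] have "b * (v * (b + c)) \<le> b * b\<^sup>2"
    using v pos by (simp add: algebra_simps power2_eq_square power3_eq_cube)
  then have one_box: "v * (b + c) \<le> b\<^sup>2"
    using pos by simp
  have "a ^ 3 + b ^ 3 + c ^ 3 - a * b * c \<le> v * (a * ?T + (b\<^sup>2 + b * c + c\<^sup>2))"
    using max(2) pos(6) unfolding V by (simp add: pos_divide_le_eq)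
  also have "\<dots> = ?D * v + c\<^sup>2 * v"
    by (simp add: algebra_simps power2_eq_square)
  finally have "c\<^sup>2 * (v - c) \<ge> 0"
    unfolding v by (simp only: algebra_simps power2_eq_square power3_eq_cube)
  then have "c \<le> v"
    using pos by (simp add: zero_le_mult_iff)
  define K where "K = b\<^sup>2 / (b + c)"
  have K: "K * (b + c) = b\<^sup>2" "v \<le> K"
    using pos one_box by (simp_all add: K_def pos_le_divide_eq)
  have "K \<le> b"
    using pos by (simp add: K_def pos_divide_le_eq power2_eq_square)
  define r where "r = (K - v) / a"
  have r: "r * a = K - v" "r \<ge> 0"
    using pos K by (simp_all add: r_def)
  define f1 where "f1 = b / (b + c) - r"
  have f1: "b * (f1 + r) = K" "c * (f1 + r) = b - K"
    using pos by (simp_all add: f1_def K_def field_simps power2_eq_square)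
  have "r * a \<le> b / (b + c) * a"
  proof -
    have "K = b / (b + c) * b"
      by (simp add: K_def power2_eq_square)
    also have "\<dots> \<le> b / (b + c) * a"
      using pos order by (intro mult_left_mono) simp_all
    finally show ?thesis
      unfolding r(1) using \<open>c \<le> v\<close> pos by linarith
  qed
  then have "r \<le> b / (b + c)"
    using pos(1) by (rule mult_right_le_imp_le)
  then have "f1 \<ge> 0"
    by (simp add: f1_def)
  have "r < 1"
    using r(1) \<open>K \<le> b\<close> \<open>c \<le> v\<close> pos order by (smt (verit) mult_less_cancel_right2)
  have "a * (?T * v) = a * (a\<^sup>2 - b * c + r * b * (b + c))"
  proof -
    have "a * (r * b * (b + c)) = (r * a) * (b * (b + c))" by (simp add: algebra_simps)
    also have "\<dots> = b * (K * (b + c)) - b * (b + c) * v"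
      unfolding r(1) by (simp add: algebra_simps)
    finally show ?thesis
      unfolding K(1) using v by (simp add: algebra_simps power2_eq_square power3_eq_cube)
  qed
  then have two_in_A: "?T * v = a\<^sup>2 - b * c + r * b * (b + c)"
    using pos by simp
  have "upper_value a b c \<le> ennreal (?T + v)"
  proof (rule upper_value_le_parametric[where r = r and t = 0 and ?f1.0 = f1 and ?f2.0 = 0])
    show "f1 + 0 \<le> 1 - (r + 0)"
      using pos by (simp add: f1_def)
    show "(r + 0) * a \<le> b" "v \<le> (1 - (r + 0)) * a + 0 * c"
      using r \<open>K \<le> b\<close> \<open>c \<le> v\<close> pos order by (simp_all add: left_diff_distrib)
    show "0 * c \<le> v + (r + 0) * (a - b)"
      using r(2) order \<open>c \<le> v\<close> by simp
    show "f1 * b + 0 * c + r * (b - a) - 0 * a \<le> v" "b - f1 * c - r * (a + c) - 0 * a \<le> v"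
      using f1 r(1) by (simp_all add: algebra_simps)
  qed (use pos r(2) \<open>f1 \<ge> 0\<close> \<open>r < 1\<close> two_in_A \<open>c \<le> v\<close> in simp_all)
  then show ?thesis
    by (simp add: V)
qed

text \<open>If \<open>V3\<close> is largest, all six placements must be equalized. Then \<open>v = V3 - (a + b + c)\<close> lies
  below both \<open>c\<close> and \<open>K = (b ^ 3 + c ^ 3) / (b\<^sup>2 + b * c + c\<^sup>2)\<close>. The equations leave one degree of
  freedom, described by the parameter \<open>m = v + t * a\<close>: the weight \<open>f2\<close> is proportional to \<open>c - m\<close>
  and \<open>r\<close> to \<open>K - m\<close>. The largest admissible \<open>m\<close>, the minimum of \<open>c\<close> and \<open>K\<close>, makes one of the
  two vanish and leaves the other weights nonnegative.\<close>

lemma upper_value_le_V3: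
  assumes order: "a \<ge> b" "b \<ge> c" "c > 0"
    and max: "V1 a b c \<le> V3 a b c" "V2 a b c \<le> V3 a b c"
  shows "upper_value a b c \<le> ennreal (V3 a b c)"
proof -
  let ?T = "a + b + c" and ?D = "a * (a + b + c) + b * (b + c)" and ?H = "b\<^sup>2 + b * c + c\<^sup>2"
  define v where "v = (a ^ 3 + b ^ 3 + c ^ 3 - a * b * c) / (a * ?T + ?H)"
  have pos: "a > 0" "b > 0" "c > 0" "?T > 0" "?D > 0" "a * ?T + ?H > 0" "b + c > 0" "?H > 0"
    using order by (simp_all add: add_pos_pos)
  note V = value_coordinates[OF pos(1-3), folded v_def]
  have "(a * ?T + ?H) * v = a ^ 3 + b ^ 3 + c ^ 3 - a * b * c"
    using pos(6) by (simp add: v_def)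
  then have v: "(a * ?T + ?H) * v = a * (a\<^sup>2 - b * c) + (b ^ 3 + c ^ 3)"
    by (simp add: algebra_simps power2_eq_square power3_eq_cube)
  have "a\<^sup>2 - b * c \<le> ?T * v"
    using max(1) pos unfolding V by (simp add: pos_divide_le_eq mult.commute)
  from mult_left_mono[OF this, of a] have two_boxes: "v * ?H \<le> b ^ 3 + c ^ 3"
    using v pos by (simp add: algebra_simps)
  have "a ^ 3 + b ^ 3 - a * b * c \<le> v * ?D"
    using max(2) pos(5) unfolding V by (simp add: pos_divide_le_eq)
  also have "\<dots> = (a * ?T + ?H) * v - c\<^sup>2 * v"
    by (simp add: algebra_simps power2_eq_square)
  finally have "c\<^sup>2 * (c - v) \<ge> 0"
    unfolding v by (simp only: algebra_simps power2_eq_square power3_eq_cube)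
  then have "v \<le> c"
    using pos by (simp add: zero_le_mult_iff)
  define K where "K = (b ^ 3 + c ^ 3) / ?H"
  have K: "K * ?H = b ^ 3 + c ^ 3" "v \<le> K" "K > 0"
  proof -
    show "K * ?H = b ^ 3 + c ^ 3"
      unfolding K_def using pos(8) by (metis less_irrefl nonzero_eq_divide_eq)
    show "v \<le> K" "K > 0"
      unfolding K_def using pos two_boxes by (simp_all add: pos_le_divide_eq add_pos_pos)
  qed
  have bc: "b * c \<le> a * a" "b * c \<le> b * b" "c * c \<le> b * c"
    using order by (simp_all add: mult_mono)
  have "v > 0"
  proof -
    have "(a * ?T + ?H) * v > 0"
      unfolding v using bc(1) pos by (simp add: add_nonneg_pos add_pos_pos power2_eq_square)
    then show ?thesis
      using pos(6) by (simp add: zero_less_mult_iff)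
  qed
  (* This inequality guarantees that the weights f1, f2, r and t leave room for f3. Clearing
     denominators turns the difference into a product of nonnegative factors. *)
  have key: "K * (b + c - a) \<le> v * (b + c)"
  proof -
    have "(a * ?T + ?H) * (?H * (v * (b + c) - K * (b + c - a))) =
        ?H * (b + c) * ((a * ?T + ?H) * v) - (a * ?T + ?H) * (b + c - a) * (K * ?H)"
      by (simp add: algebra_simps)
    also have "\<dots> = 2 * a * (b + c) * (a * a - b * c) * (b\<^sup>2 + c\<^sup>2)"
      unfolding v K by (simp add: algebra_simps power2_eq_square power3_eq_cube)
    also have "\<dots> \<ge> 0"
      using bc(1) pos by simp
    finally show ?thesis
      using pos(6,8) by (simp add: zero_le_mult_iff)
  qed
  define m where "m = min c K"
  define t where "t = (m - v) / a"
  define f2 where "f2 = (c - m) / b"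
  define r where "r = (K - m) * ?H / (a * b * (b + c))"
  define f1 where "f1 = (b - f2 * c) / (b + c) - r"
  have m: "v \<le> m" "m \<le> c" "m \<le> K" "m > 0" "m = c \<or> m = K"
    using \<open>v \<le> c\<close> K pos by (auto simp: m_def)
  have t: "t * a = m - v" "t \<ge> 0" and f2: "f2 * b = c - m" "f2 \<ge> 0"
    using pos m by (simp_all add: t_def f2_def)
  have r0: "r \<ge> 0"
    using pos m by (simp add: r_def)
  have r: "r * a * b * (b + c) = (K - m) * ?H"
    using pos by (simp add: r_def)
  (* The sum of f1 and r, which has a simpler form than either summand. *)
  define u where "u = (b - f2 * c) / (b + c)"
  have u: "u * (b + c) = b - f2 * c" and f1: "f1 = u - r"
    using pos by (simp_all add: u_def f1_def)
  have "b * (f2 * c) = c * (f2 * b)" by simp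
  then have bu: "b * (u * (b + c)) = b\<^sup>2 - c * (c - m)"
    unfolding u f2(1) by (simp add: algebra_simps power2_eq_square)
  have "b * (b + c) * (r * a) = b * (b + c) * (b - m - c * u)"
  proof -
    have "b * (b + c) * (b - m - c * u) = b * (b + c) * (b - m) - c * (b * (u * (b + c)))"
      by (simp add: algebra_simps)
    also have "\<dots> = K * ?H - m * ?H"
      unfolding bu K(1) by (simp add: algebra_simps power2_eq_square power3_eq_cube)
    finally show ?thesis
      using r by (simp add: algebra_simps)
  qed
  then have ra: "r * a = b - m - c * u"
    using pos by simp
  have "u > 0"
  proof -
    have "c * (c - m) < b\<^sup>2"
      using bc(2,3) mult_strict_left_mono[OF \<open>m > 0\<close> pos(3)]
      by (simp add: algebra_simps power2_eq_square)
    with bu pos have "b * (b + c) * u > 0"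
      by (simp add: algebra_simps)
    then show ?thesis
      using mult_pos_pos[OF pos(2,7)] by (rule zero_less_mult_pos)
  qed
  have "f1 \<ge> 0"
    using m(5)
  proof
    assume "m = c"
    then have "f2 = 0" by (simp add: f2_def)
    have "a * ((b + c) * r) = (b + c) * (r * a)" by simp
    also have "\<dots> = b * (b + c) - c * (b + c) - c * (u * (b + c))"
      unfolding ra \<open>m = c\<close> by (simp add: algebra_simps)
    also have "\<dots> = b * b - b * c - c * c"
      unfolding u \<open>f2 = 0\<close> by (simp add: algebra_simps)
    also have "\<dots> \<le> a * b"
      using mult_right_mono[OF order(1), of b] mult_pos_pos[OF pos(2,3)] mult_pos_pos[OF pos(3,3)]
        pos(2) by linarith
    also have "\<dots> = a * ((b + c) * u)"
      using u \<open>f2 = 0\<close> by (simp add: mult.commute)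
    finally show ?thesis
      using pos by (simp add: f1)
  next
    assume "m = K"
    then have "r = 0" by (simp add: r_def)
    with \<open>u > 0\<close> show ?thesis by (simp add: f1)
  qed
  have "m * (b + c - a) \<le> v * (b + c)"
  proof (cases "b + c \<ge> a")
    case True
    then have "m * (b + c - a) \<le> K * (b + c - a)"
      using m(3) by (intro mult_right_mono) simp_all
    with key show ?thesis by simp
  next
    case False
    then have "m * (b + c - a) \<le> 0"
      using m(4) by (simp add: mult_le_0_iff)
    also have "0 \<le> v * (b + c)"
      using \<open>v > 0\<close> pos by simp
    finally show ?thesis .
  qed
  then have "t * a * (b + c) \<le> a * m"
    unfolding t(1) by (simp add: algebra_simps)
  then have "a * (t * (b + c)) \<le> a * m"
    by (simp add: ac_simps)
  then have tm: "t * (b + c) \<le> m"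
    using pos by simp
  have "(b + c) * (u + f2 + t) \<le> (b + c) * 1"
    using u f2(1) tm by (simp add: algebra_simps)
  then have mass: "u + f2 + t \<le> 1"
    using pos by simp
  have pa: "(r + t) * a = b - v - c * u"
    using ra t(1) by (simp add: distrib_right)
  have "c * u > 0"
    using pos \<open>u > 0\<close> by simp
  have "(r + t) * a < 1 * a"
    using pa \<open>c * u > 0\<close> \<open>v > 0\<close> order by simp
  then have "r + t < 1"
    using pos by simp
  have "a * (?T * v) = a * (a\<^sup>2 - b * c + (r + t) * b * (b + c) + t * c\<^sup>2)"
  proof -
    have "a * ((r + t) * b * (b + c) + t * c\<^sup>2) = r * a * b * (b + c) + (t * a) * ?H"
      by (simp add: algebra_simps power2_eq_square)
    also have "\<dots> = K * ?H - v * ?H"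
      unfolding r t(1) by (simp add: algebra_simps)
    finally show ?thesis
      unfolding K(1) using v by (simp add: algebra_simps)
  qed
  then have two_in_A: "?T * v = a\<^sup>2 - b * c + (r + t) * b * (b + c) + t * c\<^sup>2"
    using pos by simp
  have "upper_value a b c \<le> ennreal (?T + v)"
  proof (rule upper_value_le_parametric[where r = r and t = t and ?f1.0 = f1 and ?f2.0 = f2])
    show "f1 + f2 \<le> 1 - (r + t)"
      using mass by (simp add: f1)
    show "(r + t) * a \<le> b"
      using pa \<open>c * u > 0\<close> \<open>v > 0\<close> by simp
    have "t * c \<ge> 0"
      using t(2) pos by simp
    then show "v \<le> (1 - (r + t)) * a + t * c"
      using pa \<open>c * u > 0\<close> order by (simp add: left_diff_distrib)
    have "r * (a - b) \<ge> 0"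
      using r0 order by simp
    then show "t * c \<le> v + (r + t) * (a - b)"
      using tm t(1) by (simp add: algebra_simps)
    show "c - f2 * b - t * a \<le> v"
      using f2 t by simp
    show "f1 * b + f2 * c + r * (b - a) - t * a \<le> v" "b - f1 * c - r * (a + c) - t * a \<le> v"
      using u ra t(1) unfolding f1 by (simp_all add: algebra_simps)
  qed (use pos r0 t f2 \<open>f1 \<ge> 0\<close> \<open>r + t < 1\<close> two_in_A in simp_all)
  then show ?thesis
    by (simp add: V)
qed

theorem theorem1:
  fixes a b c :: real
  assumes "a \<ge> b" and "b \<ge> c" and "c > 0"
  shows "let M = Max {V1 a b c, V2 a b c, V3 a b c} in
      is_game_value a b c (game_value a b c) \<and>
      game_value a b c = ennreal M \<and>
      (V1 a b c = M \<longrightarrow> optimal_hider a b c (h1 a b c)) \<and>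
      (V2 a b c = M \<longrightarrow> optimal_hider a b c (h2 a b c)) \<and>
      (V3 a b c = M \<longrightarrow> optimal_hider a b c (h3 a b c)) \<and>
      (\<forall>u v w :: real.
        0 \<le> u \<and> 0 \<le> v \<and> 0 \<le> w \<and> u + v + w = 1 \<and>
        (u \<noteq> 0 \<longrightarrow> V1 a b c = M) \<and> (v \<noteq> 0 \<longrightarrow> V2 a b c = M) \<and> (w \<noteq> 0 \<longrightarrow> V3 a b c = M) \<longrightarrow>
        optimal_hider a b c (\<lambda>x. u * h1 a b c x + v * h2 a b c x + w * h3 a b c x))"
proof -
  have pos: "a > 0" "b > 0" "c > 0"
    using assms by simp_all
  define M where "M = Max {V1 a b c, V2 a b c, V3 a b c}"
  have le_M: "V1 a b c \<le> M" "V2 a b c \<le> M" "V3 a b c \<le> M"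
    by (simp_all add: M_def)
  have "M \<in> {V1 a b c, V2 a b c, V3 a b c}"
    unfolding M_def by (rule Max_in) auto
  then have upper: "upper_value a b c \<le> ennreal M"
    using upper_value_le_V1[OF assms] upper_value_le_V2[OF assms] upper_value_le_V3[OF assms] le_M
    by auto
  have "ennreal (V1 a b c) \<le> lower_value a b c" "ennreal (V2 a b c) \<le> lower_value a b c"
    "ennreal (V3 a b c) \<le> lower_value a b c"
    unfolding lower_value_def
    using hider_mixed_h[OF pos] expected_cost_h1[OF pos] expected_cost_h2[OF pos]
      expected_cost_h3[OF pos]
    by (blast intro: SUP_upper2 INF_greatest)+
  with \<open>M \<in> _\<close> have lower: "ennreal M \<le> lower_value a b c"
    by auto
  have "lower_value a b c \<le> upper_value a b c"
    unfolding lower_value_def upper_value_def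
    by (intro SUP_least INF_greatest) (blast intro: INF_lower2 SUP_upper)
  with lower upper have game: "is_game_value a b c (ennreal M)"
    by (auto simp: is_game_value_def)
  then have val: "game_value a b c = ennreal M"
    by (rule game_value_eqI)
  have mix: "optimal_hider a b c (\<lambda>x. u * h1 a b c x + v * h2 a b c x + w * h3 a b c x)"
    if uvw: "0 \<le> u" "0 \<le> v" "0 \<le> w" "u + v + w = 1"
      and ties: "u \<noteq> 0 \<longrightarrow> V1 a b c = M" "v \<noteq> 0 \<longrightarrow> V2 a b c = M" "w \<noteq> 0 \<longrightarrow> V3 a b c = M"
    for u v w :: real
  proof -
    let ?h = "\<lambda>x. u * h1 a b c x + v * h2 a b c x + w * h3 a b c x"
    have nonneg: "h1 a b c x \<ge> 0" "h2 a b c x \<ge> 0" "h3 a b c x \<ge> 0" for x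
      using hider_mixed_h[OF pos] by (simp_all add: hider_mixed_def)
    have "?h \<in> hider_mixed"
      using hider_mixed_h[OF pos] uvw
      by (simp add: hider_mixed_def sum.distrib flip: sum_distrib_left)
    moreover have "ennreal M \<le> expected_cost a b c S ?h" if S: "S \<in> searcher_mixed" for S
    proof -
      have "ennreal M = ennreal u * ennreal M + ennreal v * ennreal M + ennreal w * ennreal M"
        using uvw by (simp flip: distrib_right ennreal_plus)
      also have "\<dots> \<le> ennreal u * expected_cost a b c S (h1 a b c) +
          ennreal v * expected_cost a b c S (h2 a b c) +
          ennreal w * expected_cost a b c S (h3 a b c)"
        using expected_cost_h1[OF pos S] expected_cost_h2[OF pos S] expected_cost_h3[OF pos S] ties
        by (intro add_mono) (metis mult_left_mono zero_le mult_zero_left ennreal_0 order_refl)+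
      also have "\<dots> = expected_cost a b c S ?h"
        using uvw nonneg
        by (simp add: expected_cost_def sum_distrib_left ennreal_mult distrib_right mult.assoc
            flip: sum.distrib)
      finally show ?thesis .
    qed
    ultimately show ?thesis
      by (simp add: optimal_hider_def val)
  qed
  show ?thesis
    unfolding Let_def M_def[symmetric]
    using game val mix mix[of 1 0 0] mix[of 0 1 0] mix[of 0 0 1] by simp
qed

end
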